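(* Let $G$ be a real form of $SL(2,\mathbb C)$, let $R$ be an irreducible unitary representation of $G$ in a complex Hilbert space $V$, and let $t'$ be an infinitesimal R-matrix in $\mathfrak{sl}(2,\mathbb C)$. After possibly rescaling $t'$ (i.e. replacing it by a nonzero scalar multiple), there exists $z\in\mathbb C$ such that $$I(G,t',R)(K)=\frac{J^z}{2z+1}(K)\in\mathbb C[[h]]$$ for every framed knot $K$.
   Context: Chord diagrams: a chord diagram with $n$ chords is a set of $n$ pairwise disjoint two-element subsets (chords) of the oriented circle, up to orientation preserving homeomorphism. $\mathcal A_n$ is the complex vector space spanned by chord diagrams with $n$ chords modulo the usual four-term (4T) relations. An infinitesimal R-matrix in a complex Lie algebra $\mathfrak a$ is a symmetric tensor $t\in\mathfrak a\otimes\mathfrak a$ with $[X\otimes1+1\otimes X,t]=0$ for all $X\in\mathfrak a$. Writing $t=\sum_i a_i\otimes b_i$, the linear map $\phi_t:\mathcal A_n\to \mathcal C(U(\mathfrak a))$ (centre of the universal enveloping algebra) is defined on a chord diagram $w$ as follows: choose a starting point on the circle, go around it in the direction of its orientation, and write from right to left $a_{i_k}$ when meeting the first endpoint of the $k$-th chord and $b_{i_k}$ when meeting its second endpoint; then sum over all indices $i_1,\dots,i_n$. This is known to be well defined. $\mathcal Z(K)=\sum_{n\ge0}\mathcal Z_n(K)h^n$, $\mathcal Z_n(K)\in\mathcal A_n$, is the framed Kontsevich integral of the framed knot $K$, normalised so that its value on the zero-framed unknot is the wheels element. The Lie algebra $\mathfrak g$ of $G$ satisfies $\mathfrak g\otimes_{\mathbb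 R}\mathbb C=\mathfrak{sl}(2,\mathbb C)$. Unitary representations are strongly continuous; irreducible means no nontrivial closed invariant subspaces. $V_\infty$ is the space of smooth vectors of $R$, $R^\infty$ the induced representation of $U(\mathfrak{sl}(2,\mathbb C))$ on $V_\infty$, and the infinitesimal character $\chi_R^\infty$ is the unique algebra morphism from the centre of $U(\mathfrak{sl}(2,\mathbb C))$ to $\mathbb C$ with $R^\infty(a)v=\chi_R^\infty(a)v$ for all $v\in V_\infty$ and central $a$ (it is known to exist). Put $I(G,t',R)(K)=\sum_{n\ge0}\chi_R^\infty(\phi_{t'}(\mathcal Z_n(K)))h^n$. For $z\in\mathbb C$, let $\lambda_z$ be the central character of the cyclic highest weight representation of $\mathfrak{sl}(2,\mathbb C)$ of highest weight $2z$. Let $t$ be the infinitesimal R-matrix of $\mathfrak{sl}(2,\mathbb C)$ coming from minus the Cartan–Killing form, i.e. $t=-\frac14\left(E\otimes F+F\otimes E+\frac12H\otimes H\right)$ in the standard basis $E,F,H$. The $z$-coloured Jones polynomial is, by definition, $\frac{J^z}{2z+1}(K)=\sum_{n\ge 0}\lambda_z(\phi_t(\mathcal Z_n(K)))h^n$ (the left hand side is a single symbol, defined also when $2z+1=0$). *)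

theory Defs
  imports "HOL-Analysis.Analysis" "HOL-Library.Poly_Mapping"
    "HOL-Computational_Algebra.Polynomial" "HOL-Computational_Algebra.Formal_Power_Series"
begin

section \<open>The Lie algebra \<open>sl(2,\<complex>)\<close>\<close>

typedef sl2 = "{A :: complex^2^2. trace A = 0}"
  morphisms mat_of sl2_of
  by (rule exI[of _ 0]) (simp add: trace_def)

setup_lifting type_definition_sl2

instantiation sl2 :: ab_group_add
begin
lift_definition zero_sl2 :: sl2 is 0 by (simp add: trace_def)
lift_definition plus_sl2 :: "sl2 \<Rightarrow> sl2 \<Rightarrow> sl2" is "(+)" by (simp add: trace_add)
lift_definition uminus_sl2 :: "sl2 \<Rightarrow> sl2" is uminus by (simp add: trace_def sum_negf)
lift_definition minus_sl2 :: "sl2 \<Rightarrow> sl2 \<Rightarrow> sl2" is "(-)" by (simp add: trace_sub)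
instance by standard (transfer; simp)+
end

lift_definition sl2_scale :: "complex \<Rightarrow> sl2 \<Rightarrow> sl2" is "\<lambda>c A. \<chi> i j. c * A $ i $ j"
  by (simp add: trace_def flip: sum_distrib_left)

lift_definition bracket :: "sl2 \<Rightarrow> sl2 \<Rightarrow> sl2" is "\<lambda>A B. A ** B - B ** A"
  by (simp add: trace_sub) (metis trace_mul_sym)

lift_definition sl2_E :: sl2 is "vector [vector [0, 1], vector [0, 0]] :: complex^2^2"
  by (simp add: trace_def sum_2)
lift_definition sl2_F :: sl2 is "vector [vector [0, 0], vector [1, 0]] :: complex^2^2"
  by (simp add: trace_def sum_2)
lift_definition sl2_H :: sl2 is "vector [vector [1, 0], vector [0, -1]] :: complex^2^2"
  by (simp add: trace_def sum_2)

definition sl2_basis :: "3 \<Rightarrow> sl2"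
  where "sl2_basis i = (if i = 1 then sl2_E else if i = 2 then sl2_F else sl2_H)"

definition sl2_coord :: "sl2 \<Rightarrow> complex^3"
  where "sl2_coord A = vector [mat_of A $ 1 $ 2, mat_of A $ 2 $ 1, mat_of A $ 1 $ 1]"

lemma sl2_expansion: "A = (\<Sum>i\<in>UNIV. sl2_scale (sl2_coord A $ i) (sl2_basis i))"
proof -
  have "mat_of A $ 2 $ 2 = - (mat_of A $ 1 $ 1)"
    using mat_of[of A] by (simp add: trace_def sum_2 add_eq_0_iff)
  then have "mat_of A = mat_of (sl2_scale (sl2_coord A $ 1) sl2_E + sl2_scale (sl2_coord A $ 2) sl2_F
      + sl2_scale (sl2_coord A $ 3) sl2_H)"
    by (simp add: sl2_coord_def plus_sl2.rep_eq sl2_scale.rep_eq sl2_E.rep_eq sl2_F.rep_eq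
        sl2_H.rep_eq vec_eq_iff forall_2)
  then show ?thesis
    by (simp add: sum_3 sl2_basis_def mat_of_inject)
qed


section \<open>The universal enveloping algebra\<close>

text \<open>
  Words under concatenation, so that \<open>'a list \<Rightarrow>\<^sub>0 complex\<close> with convolution is the free associative
  algebra on \<open>'a\<close>.
\<close>

instantiation list :: (type) monoid_add
begin
definition zero_list :: "'a list" where "zero_list = []"
definition plus_list :: "'a list \<Rightarrow> 'a list \<Rightarrow> 'a list" where "plus_list = (@)"
instance by standard (simp_all add: zero_list_def plus_list_def)
end

type_synonym sl2_words = "sl2 list \<Rightarrow>\<^sub>0 complex"

definition word_gen :: "sl2 \<Rightarrow> sl2_words"
  where "word_gen X = Poly_Mapping.single [X] 1"

definition word_const :: "complex \<Rightarrow> sl2_words"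
  where "word_const c = Poly_Mapping.single [] c"

inductive_set env_ideal :: "sl2_words set" where
  rel_add: "word_gen (X + Y) - word_gen X - word_gen Y \<in> env_ideal"
| rel_scale: "word_gen (sl2_scale c X) - word_const c * word_gen X \<in> env_ideal"
| rel_bracket: "word_gen X * word_gen Y - word_gen Y * word_gen X - word_gen (bracket X Y) \<in> env_ideal"
| zero: "0 \<in> env_ideal"
| add: "x \<in> env_ideal \<Longrightarrow> y \<in> env_ideal \<Longrightarrow> x + y \<in> env_ideal"
| mult: "x \<in> env_ideal \<Longrightarrow> a * x * b \<in> env_ideal"

lemma env_ideal_left: "x \<in> env_ideal \<Longrightarrow> a * x \<in> env_ideal"
  using env_ideal.mult[of x a 1] by simp

lemma env_ideal_right: "x \<in> env_ideal \<Longrightarrow> x * b \<in> env_ideal"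
  using env_ideal.mult[of x 1 b] by simp

lemma env_ideal_uminus: "x \<in> env_ideal \<Longrightarrow> - x \<in> env_ideal"
  using env_ideal_left[of x "-1"] by simp

definition env_rel :: "sl2_words \<Rightarrow> sl2_words \<Rightarrow> bool"
  where "env_rel x y \<longleftrightarrow> x - y \<in> env_ideal"

lemma env_rel_add: "env_rel a b \<Longrightarrow> env_rel c d \<Longrightarrow> env_rel (a + c) (b + d)"
  unfolding env_rel_def by (metis add_diff_add env_ideal.add)

lemma env_rel_uminus: "env_rel a b \<Longrightarrow> env_rel (- a) (- b)"
  unfolding env_rel_def using env_ideal_uminus[of "a - b"] by simp

lemma env_rel_mult:
  assumes "env_rel a b" "env_rel c d"
  shows "env_rel (a * c) (b * d)"
proof -
  have "a * c - b * d = (a - b) * c + b * (c - d)"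
    by (simp add: algebra_simps)
  then show ?thesis
    using assms unfolding env_rel_def
    by (metis env_ideal.add env_ideal_left env_ideal_right)
qed

lemma lookup_times_Nil:
  fixes f g :: sl2_words
  shows "Poly_Mapping.lookup (f * g) [] = Poly_Mapping.lookup f [] * Poly_Mapping.lookup g []"
proof -
  have inner: "(\<Sum>q. (Poly_Mapping.lookup g q when [] = l + q)) = (Poly_Mapping.lookup g [] when l = [])" for l
  proof (cases "l = []")
    case True
    have "(\<lambda>q. (Poly_Mapping.lookup g q when [] = l + q)) = (\<lambda>q. (Poly_Mapping.lookup g [] when q = []))"
      using True by (auto simp: plus_list_def when_def fun_eq_iff)
    from arg_cong[where f = Sum_any, OF this] show ?thesis using True by simp
  qed (simp add: plus_list_def)
  have "(\<lambda>l. Poly_Mapping.lookup f l * (Poly_Mapping.lookup g [] when l = [])) =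
      (\<lambda>l. (Poly_Mapping.lookup f [] * Poly_Mapping.lookup g [] when l = []))"
    by (auto simp: when_def fun_eq_iff)
  from arg_cong[where f = Sum_any, OF this] show ?thesis
    by (simp add: times_poly_mapping.rep_eq prod_fun_def inner)
qed

lemma env_ideal_lookup_Nil: "x \<in> env_ideal \<Longrightarrow> Poly_Mapping.lookup x [] = 0"
  by (induction rule: env_ideal.induct)
    (simp_all add: lookup_times_Nil lookup_add lookup_minus word_gen_def word_const_def lookup_single)

quotient_type usl2 = sl2_words / env_rel
proof (rule equivpI)
  show "reflp env_rel" by (simp add: reflp_def env_rel_def env_ideal.zero)
  show "symp env_rel"
  proof (rule sympI)
    fix x y assume "env_rel x y"
    then show "env_rel y x"
      unfolding env_rel_def using env_ideal_uminus[of "x - y"] by simp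
  qed
  show "transp env_rel"
  proof (rule transpI)
    fix x y z assume "env_rel x y" "env_rel y z"
    then show "env_rel x z"
      unfolding env_rel_def using env_ideal.add[of "x - y" "y - z"] by simp
  qed
qed

instantiation usl2 :: ring_1
begin
lift_definition zero_usl2 :: usl2 is 0 .
lift_definition one_usl2 :: usl2 is 1 .
lift_definition plus_usl2 :: "usl2 \<Rightarrow> usl2 \<Rightarrow> usl2" is "(+)" by (rule env_rel_add)
lift_definition uminus_usl2 :: "usl2 \<Rightarrow> usl2" is uminus by (rule env_rel_uminus)
lift_definition minus_usl2 :: "usl2 \<Rightarrow> usl2 \<Rightarrow> usl2" is "(-)"
  using env_rel_add[OF _ env_rel_uminus] by simp
lift_definition times_usl2 :: "usl2 \<Rightarrow> usl2 \<Rightarrow> usl2" is "(*)" by (rule env_rel_mult)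
instance
proof
  show "(0 :: usl2) \<noteq> 1"
  proof transfer
    have "Poly_Mapping.lookup (0 - 1 :: sl2_words) [] = -1"
      by (simp add: lookup_minus lookup_one zero_list_def)
    then show "\<not> env_rel 0 1"
      unfolding env_rel_def using env_ideal_lookup_Nil by force
  qed
qed (transfer; simp add: algebra_simps env_rel_def env_ideal.zero)+
end

lift_definition usl2_scale :: "complex \<Rightarrow> usl2 \<Rightarrow> usl2" is "\<lambda>c x. word_const c * x"
  by (rule env_rel_mult) (simp_all add: env_rel_def env_ideal.zero)

lift_definition usl2_gen :: "sl2 \<Rightarrow> usl2" is word_gen .

definition usl2_centre :: "usl2 set"
  where "usl2_centre = {a. \<forall>b. a * b = b * a}"

text \<open>
  The action of the enveloping algebra determined by operators \<open>op X\<close> (\<open>X\<close> in \<open>sl(2,\<complex>)\<close>), evaluated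
  on a representative in the free algebra. It does not depend on the representative whenever \<open>op\<close>
  is a representation on the subspace containing \<open>v\<close>.
\<close>

definition env_act :: "(complex \<Rightarrow> 'v \<Rightarrow> 'v) \<Rightarrow> (sl2 \<Rightarrow> 'v \<Rightarrow> 'v) \<Rightarrow> usl2 \<Rightarrow> 'v \<Rightarrow> 'v::ab_group_add"
  where "env_act smul op u v =
    (\<Sum>w\<in>Poly_Mapping.keys (rep_usl2 u). smul (Poly_Mapping.lookup (rep_usl2 u) w) (foldr op w v))"

definition algebra_morphism_on_centre :: "(usl2 \<Rightarrow> complex) \<Rightarrow> bool"
  where "algebra_morphism_on_centre ch \<longleftrightarrow> ch 1 = 1 \<and>
    (\<forall>a\<in>usl2_centre. \<forall>b\<in>usl2_centre. ch (a + b) = ch a + ch b \<and> ch (a * b) = ch a * ch b) \<and>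
    (\<forall>c. \<forall>a\<in>usl2_centre. ch (usl2_scale c a) = c * ch a)"


section \<open>Highest weight modules and their central characters\<close>

text \<open>
  The cyclic highest weight module of highest weight \<open>2 * z\<close>, on the polynomials in one variable:
  \<open>F\<^sup>k v\<^sub>0\<close> is the monomial of degree \<open>k\<close>.
\<close>

definition verma_E :: "complex \<Rightarrow> complex poly \<Rightarrow> complex poly"
  where "verma_E z p = smult (2 * z) (pderiv p) - [:0, 1:] * pderiv (pderiv p)"

definition verma_F :: "complex poly \<Rightarrow> complex poly"
  where "verma_F p = [:0, 1:] * p"

definition verma_H :: "complex \<Rightarrow> complex poly \<Rightarrow> complex poly"
  where "verma_H z p = smult (2 * z) p - smult 2 ([:0, 1:] * pderiv p)"

definition verma :: "complex \<Rightarrow> sl2 \<Rightarrow> complex poly \<Rightarrow> complex poly"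
  where "verma z A p = smult (sl2_coord A $ 1) (verma_E z p) + smult (sl2_coord A $ 2) (verma_F p)
    + smult (sl2_coord A $ 3) (verma_H z p)"

definition cyclic_highest_weight_rep ::
    "(complex \<Rightarrow> 'v \<Rightarrow> 'v) \<Rightarrow> (sl2 \<Rightarrow> 'v \<Rightarrow> 'v::ab_group_add) \<Rightarrow> complex \<Rightarrow> bool"
  where "cyclic_highest_weight_rep smul op wt \<longleftrightarrow>
    (\<forall>A c v w. op A (v + w) = op A v + op A w \<and> op A (smul c v) = smul c (op A v)) \<and>
    (\<forall>A B c v. op (A + B) v = op A v + op B v \<and> op (sl2_scale c A) v = smul c (op A v)) \<and>
    (\<forall>A B v. op (bracket A B) v = op A (op B v) - op B (op A v)) \<and>
    (\<exists>v0. v0 \<noteq> 0 \<and> op sl2_E v0 = 0 \<and> op sl2_H v0 = smul wt v0 \<and>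
      (\<forall>W. v0 \<in> W \<and> (\<forall>v\<in>W. \<forall>w\<in>W. v + w \<in> W) \<and> (\<forall>c. \<forall>v\<in>W. smul c v \<in> W) \<and>
        (\<forall>A. \<forall>v\<in>W. op A v \<in> W) \<longrightarrow> W = UNIV))"

lemma sl2_coord_linear:
  "sl2_coord (A + B) $ i = sl2_coord A $ i + sl2_coord B $ i"
  "sl2_coord (sl2_scale c A) $ i = c * sl2_coord A $ i"
  using exhaust_3[of i] by (auto simp: sl2_coord_def plus_sl2.rep_eq sl2_scale.rep_eq)

lemma sl2_coord_basis:
  "sl2_coord sl2_E = vector [1, 0, 0]" "sl2_coord sl2_F = vector [0, 1, 0]"
  "sl2_coord sl2_H = vector [0, 0, 1]"
  by (simp_all add: sl2_coord_def sl2_E.rep_eq sl2_F.rep_eq sl2_H.rep_eq)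

lemma sl2_coord_bracket:
  "sl2_coord (bracket A B) $ 1 = 2 * (sl2_coord A $ 3 * sl2_coord B $ 1 - sl2_coord A $ 1 * sl2_coord B $ 3)"
  "sl2_coord (bracket A B) $ 2 = 2 * (sl2_coord A $ 2 * sl2_coord B $ 3 - sl2_coord A $ 3 * sl2_coord B $ 2)"
  "sl2_coord (bracket A B) $ 3 = sl2_coord A $ 1 * sl2_coord B $ 2 - sl2_coord A $ 2 * sl2_coord B $ 1"
proof -
  have tr: "mat_of A $ 2 $ 2 = - (mat_of A $ 1 $ 1)" for A
    using mat_of[of A] by (simp add: trace_def sum_2 add_eq_0_iff)
  show "sl2_coord (bracket A B) $ 1 = 2 * (sl2_coord A $ 3 * sl2_coord B $ 1 - sl2_coord A $ 1 * sl2_coord B $ 3)"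
    "sl2_coord (bracket A B) $ 2 = 2 * (sl2_coord A $ 2 * sl2_coord B $ 3 - sl2_coord A $ 3 * sl2_coord B $ 2)"
    "sl2_coord (bracket A B) $ 3 = sl2_coord A $ 1 * sl2_coord B $ 2 - sl2_coord A $ 2 * sl2_coord B $ 1"
    by (simp_all add: sl2_coord_def bracket.rep_eq matrix_matrix_mult_def sum_2 tr algebra_simps)
qed

lemma verma_commutator:
  fixes a1 a2 a3 b1 b2 b3 w :: complex and v :: "complex poly"
  defines "E \<equiv> \<lambda>p. smult w (pderiv p) - [:0, 1:] * pderiv (pderiv p)"
  defines "F \<equiv> \<lambda>p. [:0, 1:] * p"
  defines "H \<equiv> \<lambda>p. smult w p - smult 2 ([:0, 1:] * pderiv p)"
  defines "V \<equiv> \<lambda>a1 a2 a3 p. smult a1 (E p) + smult a2 (F p) + smult a3 (H p)"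
  shows "V (2 * (a3 * b1 - a1 * b3)) (2 * (a2 * b3 - a3 * b2)) (a1 * b2 - a2 * b1) v =
    V a1 a2 a3 (V b1 b2 b3 v) - V b1 b2 b3 (V a1 a2 a3 v)"
proof -
  define X :: "complex poly" where "X = [:0, 1:]"
  define W where "W = [:w:]"
  have d: "pderiv X = 1" "pderiv W = 0" "pderiv (2 :: complex poly) = 0"
    by (simp_all add: X_def W_def pderiv_pCons numeral_poly)
  have sm: "smult w q = W * q" "smult 2 q = 2 * q" for q
    by (simp_all add: W_def numeral_poly)
  note defs = E_def F_def H_def X_def[symmetric] sm
  have EF: "E (F p) - F (E p) = H p" for p
    unfolding defs by (simp only: pderiv_mult pderiv_add pderiv_diff d) (simp add: algebra_simps)
  have HE: "H (E p) - E (H p) = 2 * E p" for p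
    unfolding defs by (simp only: pderiv_mult pderiv_add pderiv_diff d) (simp add: pderiv_mult pderiv_add pderiv_diff d algebra_simps)
  have HF: "H (F p) - F (H p) = - 2 * F p" for p
    unfolding defs by (simp only: pderiv_mult pderiv_add pderiv_diff d) (simp add: algebra_simps)
  have lin: "E (p + q) = E p + E q" "F (p + q) = F p + F q" "H (p + q) = H p + H q"
     "E (smult c p) = smult c (E p)" "F (smult c p) = smult c (F p)" "H (smult c p) = smult c (H p)" for p q c
    unfolding E_def F_def H_def
    by (simp_all add: pderiv_add pderiv_smult algebra_simps smult_add_right smult_diff_right)
  have e: "E (F v) = F (E v) + H v" "H (E v) = E (H v) + smult 2 (E v)" "H (F v) = F (H v) - smult 2 (F v)"
    using EF[of v] HE[of v] HF[of v] by (simp_all add: sm algebra_simps)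
  show ?thesis
    unfolding V_def lin e
    by (simp add: smult_add_right smult_diff_right smult_add_left smult_diff_left algebra_simps)
qed

lemma verma_cyclic_highest_weight: "cyclic_highest_weight_rep smult (verma z) (2 * z)"
proof -
  have lin: "verma z A (v + w) = verma z A v + verma z A w"
    "verma z A (smult c v) = smult c (verma z A v)" for A c v w
    by (simp_all add: verma_def verma_E_def verma_F_def verma_H_def pderiv_add pderiv_smult
        algebra_simps smult_add_right smult_diff_right)
  have lin2: "verma z (A + B) v = verma z A v + verma z B v"
    "verma z (sl2_scale c A) v = smult c (verma z A v)" for A B c v
    by (simp_all add: verma_def sl2_coord_linear smult_add_left smult_add_right algebra_simps)
  have br: "verma z (bracket A B) v = verma z A (verma z B v) - verma z B (verma z A v)" for A B v
    unfolding verma_def verma_E_def verma_F_def verma_H_def sl2_coord_bracket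
    by (rule verma_commutator)
  have gen: "W = UNIV"
    if "1 \<in> W" and add: "\<forall>v\<in>W. \<forall>w\<in>W. v + w \<in> W" and sc: "\<forall>c. \<forall>v\<in>W. smult c v \<in> W"
      and op: "\<forall>A. \<forall>v\<in>W. verma z A v \<in> W" for W
  proof -
    have "p \<in> W" for p
    proof (induction p)
      case 0
      then show ?case using sc \<open>1 \<in> W\<close> by (metis smult_0_left)
    next
      case (pCons a p)
      have "pCons a p = smult a 1 + verma z sl2_F p"
        by (simp add: verma_def sl2_coord_basis verma_F_def)
      moreover have "smult a 1 \<in> W" "verma z sl2_F p \<in> W"
        using sc op \<open>1 \<in> W\<close> pCons by blast+
      ultimately show ?case using add by metis
    qed
    then show ?thesis by blast
  qed
  have v0: "verma z sl2_E 1 = 0" "verma z sl2_H 1 = smult (2 * z) 1"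
    by (simp_all add: verma_def sl2_coord_basis verma_E_def verma_H_def)
  show ?thesis
    unfolding cyclic_highest_weight_rep_def
    by (intro conjI allI exI[of _ 1]) (simp add: lin lin2 br v0; fail | use gen in blast)+
qed

definition central_character :: "complex \<Rightarrow> usl2 \<Rightarrow> complex"
  where "central_character z u = (THE \<mu>. \<forall>p. env_act smult (verma z) u p = smult \<mu> p)"


section \<open>Chord diagrams\<close>

text \<open>The circle is \<open>sphere 0 1\<close> in the complex plane, oriented counterclockwise.\<close>

definition chord_set :: "complex set set \<Rightarrow> bool"
  where "chord_set D \<longleftrightarrow> finite D \<and> (\<forall>c\<in>D. c \<subseteq> sphere 0 1 \<and> card c = 2) \<and> disjoint D"

text \<open>
  Orientation preserving homeomorphisms of the circle are the maps \<open>cis \<theta> \<mapsto> cis (g \<theta>)\<close> for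
  continuous increasing \<open>g\<close> commuting with translation by \<open>2 * pi\<close>.
\<close>

definition circle_lift :: "(real \<Rightarrow> real) \<Rightarrow> bool"
  where "circle_lift g \<longleftrightarrow> continuous_on UNIV g \<and> strict_mono g \<and> (\<forall>\<theta>. g (\<theta> + 2 * pi) = g \<theta> + 2 * pi)"

definition circle_map :: "(real \<Rightarrow> real) \<Rightarrow> complex \<Rightarrow> complex"
  where "circle_map g p = cis (g (Arg2pi p))"

definition chord_equiv :: "complex set set \<Rightarrow> complex set set \<Rightarrow> bool"
  where "chord_equiv D D' \<longleftrightarrow> chord_set D \<and> chord_set D' \<and>
    (\<exists>g. circle_lift g \<and> D' = (`) (circle_map g) ` D)"

lemma cis_eq_cisD: "cis a = cis b \<Longrightarrow> \<exists>k::int. a = b + 2 * pi * of_int k"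
  using sincos_principal_value complex_eq_iff[of "cis a" "cis b"] sin_cos_eq_iff[of a b]
  by (auto simp: algebra_simps)

lemma circle_lift_int:
  assumes "circle_lift g"
  shows "g (\<theta> + 2 * pi * of_int k) = g \<theta> + 2 * pi * of_int k"
proof (induction k rule: int_induct[where k = 0])
  case (step1 i)
  have "g (\<theta> + 2 * pi * of_int (i + 1)) = g ((\<theta> + 2 * pi * of_int i) + 2 * pi)"
    by (simp add: algebra_simps)
  also have "\<dots> = g (\<theta> + 2 * pi * of_int i) + 2 * pi"
    using assms unfolding circle_lift_def by blast
  finally show ?case using step1 by (simp add: algebra_simps)
next
  case (step2 i)
  have "g (\<theta> + 2 * pi * of_int i) = g ((\<theta> + 2 * pi * of_int (i - 1)) + 2 * pi)"
    by (simp add: algebra_simps)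
  also have "\<dots> = g (\<theta> + 2 * pi * of_int (i - 1)) + 2 * pi"
    using assms unfolding circle_lift_def by blast
  finally show ?case using step2 by (simp add: algebra_simps)
qed simp

lemma cis_Arg2pi: "p \<in> sphere 0 1 \<Longrightarrow> cis (Arg2pi p) = p"
  using Arg2pi_eq[of p] by (simp add: cis_conv_exp)

lemma circle_map_cis:
  assumes "circle_lift g"
  shows "circle_map g (cis \<theta>) = cis (g \<theta>)"
proof -
  have "cis (Arg2pi (cis \<theta>)) = cis \<theta>"
    by (rule cis_Arg2pi) simp
  then obtain k :: int where "Arg2pi (cis \<theta>) = \<theta> + 2 * pi * of_int k"
    using cis_eq_cisD by blast
  then show ?thesis
    by (simp add: circle_map_def circle_lift_int[OF assms] flip: cis_mult)
qed

lemma circle_lift_surj: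
  assumes "circle_lift g"
  shows "surj g"
proof -
  have "\<exists>x. g x = y" for y
  proof -
    obtain k :: int where k: "(y - g 0) / (2 * pi) \<le> of_int k"
      using ex_le_of_int by blast
    obtain l :: int where l: "(g 0 - y) / (2 * pi) \<le> of_int l"
      using ex_le_of_int by blast
    have 1: "y \<le> g (2 * pi * of_int k)"
      using k circle_lift_int[OF assms, of 0 k] by (simp add: field_simps)
    have 2: "g (2 * pi * of_int (- l)) \<le> y"
      using l circle_lift_int[OF assms, of 0 "- l"] by (simp add: field_simps)
    have "2 * pi * of_int (- l) \<le> 2 * pi * of_int k"
      using assms 1 2 unfolding circle_lift_def by (metis order_trans strict_mono_less_eq)
    then show ?thesis
      using IVT'[of g, OF 2 1] assms continuous_on_subset unfolding circle_lift_def by blast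
  qed
  then show ?thesis by (metis surjI)
qed

lemma circle_lift_inv:
  assumes "circle_lift g"
  shows "circle_lift (inv g)"
proof -
  have s: "surj g" and m: "strict_mono g" and p: "g (\<theta> + 2 * pi) = g \<theta> + 2 * pi" for \<theta>
    using assms circle_lift_surj by (auto simp: circle_lift_def)
  have i: "inj g" using m by (simp add: strict_mono_imp_inj_on)
  have m': "strict_mono (inv g)"
  proof (rule strict_monoI)
    fix x y :: real assume "x < y"
    then have "g (inv g x) < g (inv g y)" by (simp add: surj_f_inv_f[OF s])
    then show "inv g x < inv g y" by (simp add: strict_mono_less[OF m])
  qed
  have "surj (inv g)" using i by (simp add: inj_imp_surj_inv)
  then have "continuous_on UNIV (inv g)"
    using m' by (intro continuous_onI_mono) (auto simp: strict_mono_less_eq)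
  moreover have "inv g (\<theta> + 2 * pi) = inv g \<theta> + 2 * pi" for \<theta>
    using inv_f_f[OF i, of "inv g \<theta> + 2 * pi"] by (simp add: p surj_f_inv_f[OF s])
  ultimately show ?thesis using m' by (simp add: circle_lift_def)
qed

lemma circle_lift_comp: "circle_lift f \<Longrightarrow> circle_lift g \<Longrightarrow> circle_lift (f \<circ> g)"
  unfolding circle_lift_def
  by (auto simp: o_def strict_mono_def intro: continuous_on_compose2[where t = UNIV])

lemma circle_map_comp:
  "circle_lift f \<Longrightarrow> circle_map f (circle_map g p) = circle_map (f \<circ> g) p"
  by (simp add: circle_map_cis circle_map_def[of g] circle_map_def[of "f \<circ> g"])

lemma circle_map_inv:
  assumes "circle_lift g" "p \<in> sphere 0 1"
  shows "circle_map (inv g) (circle_map g p) = p"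
proof -
  have "inj g" using assms(1) by (simp add: circle_lift_def strict_mono_imp_inj_on)
  then show ?thesis
    using assms by (simp add: circle_map_def[of g] circle_map_cis circle_lift_inv cis_Arg2pi)
qed

lemma part_equivp_chord_equiv: "part_equivp chord_equiv"
proof (rule part_equivpI)
  show "\<exists>D. chord_equiv D D"
  proof
    have "circle_lift (\<lambda>\<theta>. \<theta>)" by (simp add: circle_lift_def strict_mono_def)
    then show "chord_equiv {} {}"
      unfolding chord_equiv_def chord_set_def by (simp add: disjoint_def) blast
  qed
  show "symp chord_equiv"
  proof (rule sympI)
    fix D D' assume "chord_equiv D D'"
    then obtain g where D: "chord_set D" "chord_set D'" and g: "circle_lift g"
      and D': "D' = (`) (circle_map g) ` D"
      unfolding chord_equiv_def by blast
    have "circle_map (inv g) ` circle_map g ` c = c" if "c \<in> D" for c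
    proof -
      have "c \<subseteq> sphere 0 1" using D(1) that unfolding chord_set_def by blast
      then have "\<forall>p\<in>c. circle_map (inv g) (circle_map g p) = p"
        using circle_map_inv[OF g] by blast
      then show ?thesis by (simp only: image_image cong: image_cong) simp
    qed
    then have "D = (`) (circle_map (inv g)) ` D'"
      unfolding D' image_image[of "(`) (circle_map (inv g))"] by simp
    then show "chord_equiv D' D"
      unfolding chord_equiv_def using D circle_lift_inv[OF g] by blast
  qed
  show "transp chord_equiv"
  proof (rule transpI)
    fix D D' D'' assume "chord_equiv D D'" "chord_equiv D' D''"
    then obtain f g where D: "chord_set D" "chord_set D''" and fg: "circle_lift g" "circle_lift f"
      and D'': "D'' = (`) (circle_map f) ` (`) (circle_map g) ` D"
      unfolding chord_equiv_def by blast
    have "D'' = (`) (circle_map (f \<circ> g)) ` D"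
      unfolding D'' by (simp add: image_image circle_map_comp fg)
    then show "chord_equiv D D''"
      unfolding chord_equiv_def using D circle_lift_comp[OF fg(2,1)] by blast
  qed
qed

quotient_type chord_diagram = "complex set set" / partial: chord_equiv
  by (rule part_equivp_chord_equiv)

definition num_chords :: "chord_diagram \<Rightarrow> nat"
  where "num_chords D = card (rep_chord_diagram D)"

text \<open>The open counterclockwise arc from \<open>p\<close> to \<open>q\<close>.\<close>

definition ccw_arc :: "complex \<Rightarrow> complex \<Rightarrow> complex set"
  where "ccw_arc p q = {p * cis \<theta> | \<theta>. 0 < \<theta> \<and> \<theta> < Arg2pi (q / p)}"

definition has_isolated_chord :: "chord_diagram \<Rightarrow> bool"
  where "has_isolated_chord D \<longleftrightarrow> (\<exists>p q. {p, q} \<in> rep_chord_diagram D \<and>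
    (\<forall>c \<in> rep_chord_diagram D - {{p, q}}. card (c \<inter> ccw_arc p q) \<noteq> 1))"


section \<open>The space of chord diagrams modulo the four-term relations\<close>

text \<open>
  In a diagram \<open>D\<close> with a chord \<open>{p, q}\<close> and a further point \<open>r\<close> of the circle, a chord from \<open>r\<close>
  is attached immediately after or before \<open>p\<close>, and immediately after or before \<open>q\<close>.
\<close>

definition just_after :: "complex set \<Rightarrow> complex \<Rightarrow> complex \<Rightarrow> bool"
  where "just_after S p p' \<longleftrightarrow> p' \<in> sphere 0 1 - S \<and> ccw_arc p p' \<inter> S = {}"

definition just_before :: "complex set \<Rightarrow> complex \<Rightarrow> complex \<Rightarrow> bool"
  where "just_before S p p' \<longleftrightarrow> p' \<in> sphere 0 1 - S \<and> ccw_arc p' p \<inter> S = {}"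

definition diagram_single :: "complex set set \<Rightarrow> chord_diagram \<Rightarrow>\<^sub>0 complex"
  where "diagram_single D = Poly_Mapping.single (abs_chord_diagram D) 1"

inductive_set four_term_span :: "(chord_diagram \<Rightarrow>\<^sub>0 complex) set" where
  relator: "\<lbrakk>chord_set D; {p, q} \<in> D; r \<in> sphere 0 1 - \<Union>D;
      just_after (insert r (\<Union>D)) p p_after; just_before (insert r (\<Union>D)) p p_before;
      just_after (insert r (\<Union>D)) q q_after; just_before (insert r (\<Union>D)) q q_before\<rbrakk> \<Longrightarrow>
    diagram_single (insert {r, p_after} D) - diagram_single (insert {r, p_before} D)
    + diagram_single (insert {r, q_after} D) - diagram_single (insert {r, q_before} D) \<in> four_term_span"
| zero: "0 \<in> four_term_span"
| add: "x \<in> four_term_span \<Longrightarrow> y \<in> four_term_span \<Longrightarrow> x + y \<in> four_term_span"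
| scale: "x \<in> four_term_span \<Longrightarrow> Poly_Mapping.map ((*) c) x \<in> four_term_span"

lemma pm_scale_minus_one: "Poly_Mapping.map ((*) (-1)) (x :: 'a \<Rightarrow>\<^sub>0 complex) = - x"
  by (rule poly_mapping_eqI) (simp add: Poly_Mapping.map.rep_eq when_def)

lemma pm_scale_diff:
  "Poly_Mapping.map ((*) c) (x - y :: 'a \<Rightarrow>\<^sub>0 complex) = Poly_Mapping.map ((*) c) x - Poly_Mapping.map ((*) c) y"
  by (rule poly_mapping_eqI) (simp add: lookup_minus Poly_Mapping.map.rep_eq when_def algebra_simps)

lemma four_term_span_uminus: "x \<in> four_term_span \<Longrightarrow> - x \<in> four_term_span"
  using four_term_span.scale[of x "-1"] by (simp only: pm_scale_minus_one)

definition four_term_rel :: "(chord_diagram \<Rightarrow>\<^sub>0 complex) \<Rightarrow> (chord_diagram \<Rightarrow>\<^sub>0 complex) \<Rightarrow> bool"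
  where "four_term_rel x y \<longleftrightarrow> x - y \<in> four_term_span"

lemma four_term_rel_add: "four_term_rel a b \<Longrightarrow> four_term_rel c d \<Longrightarrow> four_term_rel (a + c) (b + d)"
  unfolding four_term_rel_def by (metis add_diff_add four_term_span.add)

lemma four_term_rel_uminus: "four_term_rel a b \<Longrightarrow> four_term_rel (- a) (- b)"
  unfolding four_term_rel_def using four_term_span_uminus[of "a - b"] by simp

text \<open>The direct sum of the spaces \<open>\<A>\<^sub>n\<close> over all \<open>n\<close>.\<close>

quotient_type chord_space = "chord_diagram \<Rightarrow>\<^sub>0 complex" / four_term_rel
proof (rule equivpI)
  show "reflp four_term_rel" by (simp add: reflp_def four_term_rel_def four_term_span.zero)
  show "symp four_term_rel"
  proof (rule sympI)
    fix x y assume "four_term_rel x y"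
    then show "four_term_rel y x"
      unfolding four_term_rel_def using four_term_span_uminus[of "x - y"] by simp
  qed
  show "transp four_term_rel"
  proof (rule transpI)
    fix x y z assume "four_term_rel x y" "four_term_rel y z"
    then show "four_term_rel x z"
      unfolding four_term_rel_def using four_term_span.add[of "x - y" "y - z"] by simp
  qed
qed

instantiation chord_space :: ab_group_add
begin
lift_definition zero_chord_space :: chord_space is 0 .
lift_definition plus_chord_space :: "chord_space \<Rightarrow> chord_space \<Rightarrow> chord_space" is "(+)"
  by (rule four_term_rel_add)
lift_definition uminus_chord_space :: "chord_space \<Rightarrow> chord_space" is uminus
  by (rule four_term_rel_uminus)
lift_definition minus_chord_space :: "chord_space \<Rightarrow> chord_space \<Rightarrow> chord_space" is "(-)"
  using four_term_rel_add[OF _ four_term_rel_uminus] by simp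
instance
  by standard (transfer; simp add: algebra_simps four_term_rel_def four_term_span.zero)+
end

lift_definition cs_scale :: "complex \<Rightarrow> chord_space \<Rightarrow> chord_space" is "\<lambda>c. Poly_Mapping.map ((*) c)"
  unfolding four_term_rel_def by (simp flip: pm_scale_diff add: four_term_span.scale)

definition diagram_class :: "complex set set \<Rightarrow> chord_space"
  where "diagram_class D = abs_chord_space (diagram_single D)"

text \<open>Connected sum of chord diagrams: both circles are cut open at the point \<open>1\<close>.\<close>

definition connected_sum :: "complex set set \<Rightarrow> complex set set \<Rightarrow> complex set set"
  where "connected_sum D D' =
    (`) (\<lambda>p. cis (Arg2pi p / 2)) ` D \<union> (`) (\<lambda>p. cis (pi + Arg2pi p / 2)) ` D'"

definition cs_mult :: "chord_space \<Rightarrow> chord_space \<Rightarrow> chord_space"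
  where "cs_mult x y =
    (\<Sum>D\<in>Poly_Mapping.keys (rep_chord_space x). \<Sum>D'\<in>Poly_Mapping.keys (rep_chord_space y).
      cs_scale (Poly_Mapping.lookup (rep_chord_space x) D * Poly_Mapping.lookup (rep_chord_space y) D')
        (diagram_class (connected_sum (rep_chord_diagram D) (rep_chord_diagram D'))))"

definition cs_one :: chord_space
  where "cs_one = diagram_class {}"

definition cs_Theta :: chord_space
  where "cs_Theta = diagram_class {{1, -1}}"

definition cs_power :: "chord_space \<Rightarrow> nat \<Rightarrow> chord_space"
  where "cs_power x k = (cs_mult x ^^ k) cs_one"

text \<open>
  The deframing map. It annihilates the diagrams with an isolated chord and is a section, as an
  algebra homomorphism, of the projection onto the quotient by those diagrams.
\<close>

definition deframe :: "chord_diagram \<Rightarrow> chord_space"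
  where "deframe D = (\<Sum>J\<in>Pow (rep_chord_diagram D).
    cs_mult (cs_power (- cs_Theta) (num_chords D - card J)) (diagram_class J))"

text \<open>Formal series with \<open>n\<close>-th coefficient in \<open>\<A>\<^sub>n\<close>.\<close>

type_synonym chord_series = "nat \<Rightarrow> chord_space"

definition series_mult :: "chord_series \<Rightarrow> chord_series \<Rightarrow> chord_series"
  where "series_mult x y n = (\<Sum>k\<le>n. cs_mult (x k) (y (n - k)))"

definition series_one :: chord_series
  where "series_one n = (if n = 0 then cs_one else 0)"

text \<open>The inverse of a series with constant coefficient \<open>cs_one\<close>.\<close>

fun series_inverse :: "chord_series \<Rightarrow> chord_series"
  where "series_inverse x n =
    (if n = 0 then cs_one else - (\<Sum>k<n. cs_mult (x (n - k)) (series_inverse x k)))"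

definition series_power :: "chord_series \<Rightarrow> nat \<Rightarrow> chord_series"
  where "series_power x k = (series_mult x ^^ k) series_one"


section \<open>Knots and framings\<close>

primrec Ck_on :: "nat \<Rightarrow> 'a::euclidean_space set \<Rightarrow> ('a \<Rightarrow> 'b::real_normed_vector) \<Rightarrow> bool"
  where
    "Ck_on 0 U f \<longleftrightarrow> continuous_on U f"
  | "Ck_on (Suc k) U f \<longleftrightarrow> continuous_on U f \<and>
      (\<forall>b\<in>Basis. \<exists>f'. (\<forall>x\<in>U. ((\<lambda>s. f (x + s *\<^sub>R b)) has_vector_derivative f' x) (at 0)) \<and> Ck_on k U f')"

text \<open>Smoothness on an open set; \<open>Ck_on\<close> says that all partial derivatives up to order \<open>k\<close>
  exist and are continuous.\<close>

definition smooth_on :: "'a::euclidean_space set \<Rightarrow> ('a \<Rightarrow> 'b::real_normed_vector) \<Rightarrow> bool"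
  where "smooth_on U f \<longleftrightarrow> (\<forall>k. Ck_on k U f)"

text \<open>A knot is a smoothly embedded circle, given by a parametrisation of period \<open>1\<close>.\<close>

definition velocity :: "(real \<Rightarrow> real^3) \<Rightarrow> real \<Rightarrow> real^3"
  where "velocity \<gamma> s = vector_derivative \<gamma> (at s)"

definition knot :: "(real \<Rightarrow> real^3) \<Rightarrow> bool"
  where "knot \<gamma> \<longleftrightarrow> smooth_on UNIV \<gamma> \<and> (\<forall>s. velocity \<gamma> s \<noteq> 0) \<and>
    (\<forall>s s'. \<gamma> s = \<gamma> s' \<longleftrightarrow> s - s' \<in> \<int>)"

definition knot_isotopic :: "(real \<Rightarrow> real^3) \<Rightarrow> (real \<Rightarrow> real^3) \<Rightarrow> bool"
  where "knot_isotopic \<gamma> \<delta> \<longleftrightarrow> (\<exists>\<Phi> :: real \<times> real \<Rightarrow> real^3. smooth_on UNIV \<Phi> \<and>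
    (\<forall>\<tau>\<in>{0..1}. knot (\<lambda>s. \<Phi> (\<tau>, s))) \<and> (\<forall>s. \<Phi> (0, s) = \<gamma> s) \<and> (\<forall>s. \<Phi> (1, s) = \<delta> s))"

type_synonym framed_curve = "(real \<Rightarrow> real^3) \<times> (real \<Rightarrow> real^3)"

definition framed_knot :: "framed_curve \<Rightarrow> bool"
  where "framed_knot K \<longleftrightarrow> knot (fst K) \<and> smooth_on UNIV (snd K) \<and>
    (\<forall>s. snd K (s + 1) = snd K s) \<and> (\<forall>s a. snd K s \<noteq> a *\<^sub>R velocity (fst K) s)"

text \<open>Gauss linking integral of two disjoint closed curves.\<close>

definition linking_number :: "(real \<Rightarrow> real^3) \<Rightarrow> (real \<Rightarrow> real^3) \<Rightarrow> real"
  where "linking_number \<gamma> \<delta> = integral ({0..1} \<times> {0..1}) (\<lambda>(s, u).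
    det (vector [velocity \<gamma> s, velocity \<delta> u, \<gamma> s - \<delta> u] :: real^3^3) / norm (\<gamma> s - \<delta> u) ^ 3) / (4 * pi)"

definition framing_number :: "framed_curve \<Rightarrow> real"
  where "framing_number K =
    Lim (at_right 0) (\<lambda>\<epsilon>. linking_number (fst K) (\<lambda>s. fst K s + \<epsilon> *\<^sub>R snd K s))"


section \<open>The framed Kontsevich integral\<close>

text \<open>Space is \<open>\<complex> \<times> \<real>\<close> with the third coordinate as height.\<close>

definition planar :: "real^3 \<Rightarrow> complex"
  where "planar x = Complex (x $ 1) (x $ 2)"

definition height :: "(real \<Rightarrow> real^3) \<Rightarrow> real \<Rightarrow> real"
  where "height \<gamma> s = \<gamma> s $ 3"

definition morse_knot :: "(real \<Rightarrow> real^3) \<Rightarrow> bool"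
  where "morse_knot \<gamma> \<longleftrightarrow> knot \<gamma> \<and>
    (\<forall>s. deriv (height \<gamma>) s = 0 \<longrightarrow> deriv (deriv (height \<gamma>)) s \<noteq> 0) \<and>
    (\<forall>s s'. deriv (height \<gamma>) s = 0 \<and> deriv (height \<gamma>) s' = 0 \<and> height \<gamma> s = height \<gamma> s' \<longrightarrow> s - s' \<in> \<int>)"

definition num_maxima :: "(real \<Rightarrow> real^3) \<Rightarrow> nat"
  where "num_maxima \<gamma> =
    card {s \<in> {0..<1}. deriv (height \<gamma>) s = 0 \<and> deriv (deriv (height \<gamma>)) s < 0}"

text \<open>The derivative of the complex coordinate along the strand, with respect to height.\<close>

definition slope :: "(real \<Rightarrow> real^3) \<Rightarrow> real \<Rightarrow> complex"
  where "slope \<gamma> s = planar (velocity \<gamma> s) / of_real (deriv (height \<gamma>) s)"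

text \<open>
  For a pair of parameters at the same height, the coefficient of \<open>dt\<close> in \<open>dlog (z - z')\<close>, with a
  sign \<open>-1\<close> for each endpoint at which the knot is directed downwards; the expression is symmetric
  in the two endpoints.
\<close>

definition chord_form :: "(real \<Rightarrow> real^3) \<Rightarrow> real set \<Rightarrow> complex"
  where "chord_form \<gamma> c = (let s = Min c; s' = Max c in
    of_real (sgn (deriv (height \<gamma>) s) * sgn (deriv (height \<gamma>) s')) *
    (slope \<gamma> s - slope \<gamma> s') / (planar (\<gamma> s) - planar (\<gamma> s')))"

text \<open>The choices of an unordered pair of distinct points of the knot at each of the levels \<open>t j\<close>.\<close>

definition pairings :: "(real \<Rightarrow> real^3) \<Rightarrow> nat \<Rightarrow> (nat \<Rightarrow> real) \<Rightarrow> (nat \<Rightarrow> real set) set"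
  where "pairings \<gamma> m t = (\<Pi>\<^sub>E j\<in>{..<m}. {c. c \<subseteq> {s \<in> {0..<1}. height \<gamma> s = t j} \<and> card c = 2})"

definition pairing_diagram :: "nat \<Rightarrow> (nat \<Rightarrow> real set) \<Rightarrow> chord_diagram"
  where "pairing_diagram m P = abs_chord_diagram ((\<lambda>j. (\<lambda>s. cis (2 * pi * s)) ` P j) ` {..<m})"

definition kontsevich_coeff :: "(real \<Rightarrow> real^3) \<Rightarrow> nat \<Rightarrow> chord_diagram \<Rightarrow> complex"
  where "kontsevich_coeff \<gamma> m D = 1 / (2 * of_real pi * \<i>) ^ m *
    (\<integral>t. (if strict_mono_on {..<m} t
          then \<Sum>P\<in>{P \<in> pairings \<gamma> m t. pairing_diagram m P = D}. \<Prod>j<m. chord_form \<gamma> (P j)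
          else 0) \<partial>(\<Pi>\<^sub>M j\<in>{..<m}. (lborel :: real measure)))"

text \<open>
  The preliminary integral of a Morse knot takes values in the quotient by the diagrams with an
  isolated chord (whose coefficients may diverge); it is mapped back by the deframing map.
\<close>

definition kontsevich_preliminary :: "(real \<Rightarrow> real^3) \<Rightarrow> chord_series"
  where "kontsevich_preliminary \<gamma> m =
    (\<Sum>D | num_chords D = m \<and> \<not> has_isolated_chord D. cs_scale (kontsevich_coeff \<gamma> m D) (deframe D))"

definition round_circle :: "real \<Rightarrow> real^3"
  where "round_circle s = vector [cos (2 * pi * s), sin (2 * pi * s), 0]"

text \<open>The value of the preliminary integral does not depend on the choice of this knot.\<close>

definition hump :: "real \<Rightarrow> real^3"
  where "hump = (SOME \<gamma>. morse_knot \<gamma> \<and> knot_isotopic round_circle \<gamma> \<and> num_maxima \<gamma> = 2)"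

definition morse_representative :: "(real \<Rightarrow> real^3) \<Rightarrow> real \<Rightarrow> real^3"
  where "morse_representative \<gamma> = (SOME \<delta>. morse_knot \<delta> \<and> knot_isotopic \<gamma> \<delta>)"

text \<open>
  One factor \<open>Z(hump)\<^sup>-\<^sup>1\<close>, the wheels element, for each maximum, and the factor \<open>exp (w * \<Theta> / 2)\<close>
  for framing number \<open>w\<close>.
\<close>

definition kontsevich_integral :: "framed_curve \<Rightarrow> chord_series"
  where "kontsevich_integral K = (let \<gamma> = morse_representative (fst K) in
    series_mult (\<lambda>n. cs_scale (of_real ((framing_number K / 2) ^ n / fact n)) (cs_power cs_Theta n))
      (series_mult (kontsevich_preliminary \<gamma>)
        (series_power (series_inverse (kontsevich_preliminary hump)) (num_maxima \<gamma>))))"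


section \<open>Infinitesimal R-matrices and the universal weight system\<close>

text \<open>\<open>sl(2,\<complex>) \<otimes> sl(2,\<complex>)\<close> is realised as \<open>complex^3^3\<close>, in the basis \<open>sl2_basis i \<otimes> sl2_basis j\<close>.\<close>

definition tensor :: "sl2 \<Rightarrow> sl2 \<Rightarrow> complex^3^3"
  where "tensor A B = (\<chi> i j. sl2_coord A $ i * sl2_coord B $ j)"

definition tensor_scale :: "complex \<Rightarrow> complex^3^3 \<Rightarrow> complex^3^3"
  where "tensor_scale c t = (\<chi> i j. c * t $ i $ j)"

text \<open>\<open>[X \<otimes> 1 + 1 \<otimes> X, t]\<close>\<close>

definition tensor_ad :: "sl2 \<Rightarrow> complex^3^3 \<Rightarrow> complex^3^3"
  where "tensor_ad X t = (\<Sum>i\<in>UNIV. \<Sum>j\<in>UNIV. tensor_scale (t $ i $ j)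
    (tensor (bracket X (sl2_basis i)) (sl2_basis j) + tensor (sl2_basis i) (bracket X (sl2_basis j))))"

definition infinitesimal_R_matrix :: "complex^3^3 \<Rightarrow> bool"
  where "infinitesimal_R_matrix t \<longleftrightarrow> transpose t = t \<and> (\<forall>X. tensor_ad X t = 0)"

text \<open>Dual to minus the Killing form \<open>B\<close>, for which \<open>B(E, F) = 4\<close> and \<open>B(H, H) = 8\<close>.\<close>

definition killing_tensor :: "complex^3^3"
  where "killing_tensor = tensor_scale (- 1 / 4)
    (tensor sl2_E sl2_F + tensor sl2_F sl2_E + tensor_scale (1 / 2) (tensor sl2_H sl2_H))"

text \<open>
  The tensor is \<open>\<Sum>i j. t $ i $ j * (sl2_basis i \<otimes> sl2_basis j)\<close>, so that the summation index of a
  chord is a pair \<open>(i, j)\<close>. The starting point is \<open>1\<close>, and \<open>Arg2pi\<close> lists the endpoints in the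
  order in which they are met.
\<close>

definition weight_letter :: "complex set set \<Rightarrow> (complex set \<Rightarrow> 3 \<times> 3) \<Rightarrow> real \<Rightarrow> usl2"
  where "weight_letter D \<iota> \<theta> = (let c = (THE c. c \<in> D \<and> cis \<theta> \<in> c) in
    usl2_gen (sl2_basis (if \<theta> = Min (Arg2pi ` c) then fst (\<iota> c) else snd (\<iota> c))))"

definition weight_diagram :: "complex^3^3 \<Rightarrow> complex set set \<Rightarrow> usl2"
  where "weight_diagram t D = (\<Sum>\<iota>\<in>(\<Pi>\<^sub>E c\<in>D. UNIV).
    usl2_scale (\<Prod>c\<in>D. t $ fst (\<iota> c) $ snd (\<iota> c))
      (prod_list (rev (map (weight_letter D \<iota>) (sorted_list_of_set (Arg2pi ` \<Union>D))))))"

definition weight_system :: "complex^3^3 \<Rightarrow> chord_space \<Rightarrow> usl2"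
  where "weight_system t x = (\<Sum>D\<in>Poly_Mapping.keys (rep_chord_space x).
    usl2_scale (Poly_Mapping.lookup (rep_chord_space x) D) (weight_diagram t (rep_chord_diagram D)))"

definition coloured_jones :: "complex \<Rightarrow> framed_curve \<Rightarrow> complex fps"
  where "coloured_jones z K =
    Abs_fps (\<lambda>n. central_character z (weight_system killing_tensor (kontsevich_integral K n)))"


section \<open>Unitary representations of real forms\<close>

class complex_hilbert = banach +
  fixes scaleC :: "complex \<Rightarrow> 'a \<Rightarrow> 'a"
    and cinner :: "'a \<Rightarrow> 'a \<Rightarrow> complex"
  assumes scaleC_add_right: "scaleC c (x + y) = scaleC c x + scaleC c y"
    and scaleC_add_left: "scaleC (c + d) x = scaleC c x + scaleC d x"
    and scaleC_scaleC: "scaleC c (scaleC d x) = scaleC (c * d) x"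
    and scaleC_of_real: "scaleC (of_real r) x = r *\<^sub>R x"
    and cinner_commute: "cinner x y = cnj (cinner y x)"
    and cinner_add_left: "cinner (x + y) w = cinner x w + cinner y w"
    and cinner_scaleC_left: "cinner (scaleC c x) y = c * cinner x y"
    and cinner_norm: "cinner x x = of_real ((norm x)\<^sup>2)"

instantiation complex :: complex_hilbert
begin
definition scaleC_complex :: "complex \<Rightarrow> complex \<Rightarrow> complex" where "scaleC_complex = (*)"
definition cinner_complex :: "complex \<Rightarrow> complex \<Rightarrow> complex" where "cinner_complex x y = x * cnj y"
instance
  by standard
    (simp_all add: scaleC_complex_def cinner_complex_def algebra_simps scaleR_conv_of_real
      complex_norm_square[symmetric])
end

primrec matrix_power :: "complex^2^2 \<Rightarrow> nat \<Rightarrow> complex^2^2"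
  where
    "matrix_power A 0 = mat 1"
  | "matrix_power A (Suc n) = A ** matrix_power A n"

definition matrix_exp :: "complex^2^2 \<Rightarrow> complex^2^2"
  where "matrix_exp A = suminf (\<lambda>n. (1 / fact n) *\<^sub>R matrix_power A n)"

definition lie_algebra :: "(complex^2^2) set \<Rightarrow> sl2 set"
  where "lie_algebra G = {X. \<forall>s::real. matrix_exp (s *\<^sub>R mat_of X) \<in> G}"

text \<open>Closed subgroups \<open>G\<close> of \<open>SL(2,\<complex>)\<close> whose Lie algebra \<open>g\<close> satisfies \<open>sl(2,\<complex>) = g \<oplus> i g\<close>.\<close>

definition real_form :: "(complex^2^2) set \<Rightarrow> bool"
  where "real_form G \<longleftrightarrow> closed G \<and> (\<forall>g\<in>G. det g = 1) \<and>
    mat 1 \<in> G \<and> (\<forall>g\<in>G. \<forall>h\<in>G. g ** h \<in> G) \<and> (\<forall>g\<in>G. matrix_inv g \<in> G) \<and>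
    (\<forall>A. \<exists>!(X, Y). X \<in> lie_algebra G \<and> Y \<in> lie_algebra G \<and> A = X + sl2_scale \<i> Y)"

type_synonym 'v group_rep = "complex^2^2 \<Rightarrow> 'v \<Rightarrow> 'v"

definition unitary_rep :: "(complex^2^2) set \<Rightarrow> 'v::complex_hilbert group_rep \<Rightarrow> bool"
  where "unitary_rep G R \<longleftrightarrow>
    (\<forall>g\<in>G. \<forall>c v w. R g (v + w) = R g v + R g w \<and> R g (scaleC c v) = scaleC c (R g v) \<and>
      cinner (R g v) (R g w) = cinner v w) \<and>
    (\<forall>v. R (mat 1) v = v) \<and> (\<forall>g\<in>G. \<forall>h\<in>G. \<forall>v. R (g ** h) v = R g (R h v)) \<and>
    (\<forall>v. continuous_on G (\<lambda>g. R g v))"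

definition irreducible_rep :: "(complex^2^2) set \<Rightarrow> 'v::complex_hilbert group_rep \<Rightarrow> bool"
  where "irreducible_rep G R \<longleftrightarrow> (\<forall>W. closed W \<and> 0 \<in> W \<and> (\<forall>v\<in>W. \<forall>w\<in>W. v + w \<in> W) \<and>
    (\<forall>c. \<forall>v\<in>W. scaleC c v \<in> W) \<and> (\<forall>g\<in>G. \<forall>v\<in>W. R g v \<in> W) \<longrightarrow> W = {0} \<or> W = UNIV)"

text \<open>Smoothness of a map on an embedded submanifold: it extends locally to a smooth map on the
  ambient space.\<close>

definition smooth_vectors :: "(complex^2^2) set \<Rightarrow> 'v::complex_hilbert group_rep \<Rightarrow> 'v set"
  where "smooth_vectors G R = {v. \<forall>g\<in>G. \<exists>U f. open U \<and> g \<in> U \<and> smooth_on U f \<and> (\<forall>h\<in>U \<inter> G. f h = R h v)}"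

definition lie_derivative :: "'v::complex_hilbert group_rep \<Rightarrow> sl2 \<Rightarrow> 'v \<Rightarrow> 'v"
  where "lie_derivative R X v = vector_derivative (\<lambda>s. R (matrix_exp (s *\<^sub>R mat_of X)) v) (at 0)"

text \<open>The derived representation, extended complex linearly from \<open>g\<close> to \<open>sl(2,\<complex>)\<close>.\<close>

definition derived_rep :: "(complex^2^2) set \<Rightarrow> 'v::complex_hilbert group_rep \<Rightarrow> sl2 \<Rightarrow> 'v \<Rightarrow> 'v"
  where "derived_rep G R A v =
    (case THE (X, Y). X \<in> lie_algebra G \<and> Y \<in> lie_algebra G \<and> A = X + sl2_scale \<i> Y of
      (X, Y) \<Rightarrow> lie_derivative R X v + scaleC \<i> (lie_derivative R Y v))"

text \<open>
  The character is a total function on the enveloping algebra; only its values on the centre are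
  constrained (and used).
\<close>

definition infinitesimal_character ::
    "(complex^2^2) set \<Rightarrow> 'v::complex_hilbert group_rep \<Rightarrow> (usl2 \<Rightarrow> complex) \<Rightarrow> bool"
  where "infinitesimal_character G R ch \<longleftrightarrow> algebra_morphism_on_centre ch \<and>
    (\<forall>a\<in>usl2_centre. \<forall>v\<in>smooth_vectors G R. env_act scaleC (derived_rep G R) a v = scaleC (ch a) v)"

definition rep_invariant :: "(usl2 \<Rightarrow> complex) \<Rightarrow> complex^3^3 \<Rightarrow> framed_curve \<Rightarrow> complex fps"
  where "rep_invariant ch t K = Abs_fps (\<lambda>n. ch (weight_system t (kontsevich_integral K n)))"

end

theory Submission
  imports Defs
begin

text \<open>
  Both invariants are obtained by applying the same kind of data to the Kontsevich integral: a
  weight system with values in the centre of \<open>U = U(sl(2,\<complex>))\<close>, followed by a character of the centre.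
  The proof compares these two ingredients separately, for arbitrary elements of the space of chord
  diagrams.

  Evaluating the invariance condition on weight vectors leaves only multiples of the
  Killing tensor (\<open>infinitesimal_R_matrix_multiple\<close>), so a nonzero \<open>t'\<close> becomes equal to the Killing
  tensor after rescaling.

  The centre of \<open>U\<close> is generated by the Casimir element \<open>casimir\<close>
  (\<open>centre_casimir_poly\<close>), so a character of the centre is determined by its value there. On the
  highest weight module of highest weight \<open>2 * z\<close> the Casimir element acts by \<open>4 * z * (z + 1)\<close>, and
  this quadratic expression takes every complex value. Hence every character of the centre, and in
  particular the infinitesimal character of a representation, is the central character for some \<open>z\<close>
  (\<open>morphism_is_central_character\<close>).

  That the centre is no larger is seen in two steps. First, \<open>U\<close> is spanned by the elements \<open>E ^ m * a\<close> and
  \<open>F ^ m * a\<close> with \<open>a\<close> a polynomial in \<open>H\<close> and the Casimir element. These are eigenvectors of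
  \<open>ad H\<close> with eigenvalues \<open>2 * m\<close> and \<open>- 2 * m\<close>, so whatever commutes with \<open>H\<close> is itself such a
  polynomial \<open>a\<close>. Second, a central element acts by a scalar on each highest weight module, whereas
  \<open>H\<close> takes the infinitely many values \<open>2 * z - 2 * k\<close> there; this forces the polynomial to be constant in \<open>H\<close>.

  For these facts to apply, the weight system has to take central values
  (\<open>weight_diagram_central\<close>): the commutator of \<open>X\<close> with a product of letters replaces one letter at a
  time by its bracket with \<open>X\<close>, and the two replacements at the ends of one chord cancel after summation, by
  invariance of the tensor.

  There remains \<open>t' = 0\<close>. Its weight system only sees the diagram without chords, and
  so does the central character for \<open>z = 0\<close> composed with the Killing weight system, because that
  character is the one of the trivial representation, which annihilates every nonempty product of letters
  (\<open>trivial_character_weight_diagram\<close>).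
\<close>

section \<open>The enveloping algebra as a complex algebra\<close>

text \<open>
  Additive properties need only be checked on monomials; this reduces statements about the free
  algebra to single words.
\<close>

lemma poly_mapping_single_induct [case_names zero single add]:
  fixes x :: "'a \<Rightarrow>\<^sub>0 'b::monoid_add"
  assumes "P 0" "\<And>w c. P (Poly_Mapping.single w c)" "\<And>x y. P x \<Longrightarrow> P y \<Longrightarrow> P (x + y)"
  shows "P x"
proof (induction x rule: update_induct)
  case (update f a b)
  have "Poly_Mapping.update a b f = f + Poly_Mapping.single a b"
    using update.hyps
    by (intro poly_mapping_eqI) (auto simp: lookup_update lookup_add lookup_single in_keys_iff when_def)
  then show ?case using assms update by metis
qed (fact assms)

lemma word_const_commute: "word_const c * x = x * word_const c"
  by (induction x rule: poly_mapping_single_induct)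
    (simp_all add: word_const_def mult_single plus_list_def algebra_simps)

lemma word_const_mult: "word_const c * word_const d = word_const (c * d)"
  by (simp add: word_const_def mult_single plus_list_def)

lemma word_const_add: "word_const (c + d) = word_const c + word_const d"
  by (simp add: word_const_def single_add)

lemma word_const_one: "word_const 1 = 1"
  by (simp add: word_const_def single_one zero_list_def[symmetric])

lemma env_rel_refl: "env_rel x x"
  by (simp add: env_rel_def env_ideal.zero)

lemma usl2_scale_mult_left: "usl2_scale c x * y = usl2_scale c (x * y)"
  by transfer (simp add: mult.assoc env_rel_refl)

lemma usl2_scale_mult_right: "x * usl2_scale c y = usl2_scale c (x * y)"
  by transfer (metis mult.assoc word_const_commute env_rel_refl)

lemma usl2_scale_scale: "usl2_scale c (usl2_scale d x) = usl2_scale (c * d) x"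
  by transfer (simp add: mult.assoc[symmetric] word_const_mult env_rel_refl)

lemma usl2_scale_one [simp]: "usl2_scale 1 x = x"
  by transfer (simp add: word_const_one env_rel_refl)

lemma usl2_scale_add_left: "usl2_scale (c + d) x = usl2_scale c x + usl2_scale d x"
  by transfer (simp add: word_const_add distrib_right env_rel_refl)

lemma usl2_scale_add_right: "usl2_scale c (x + y) = usl2_scale c x + usl2_scale c y"
  by transfer (simp add: distrib_left env_rel_refl)

lemma usl2_scale_zero [simp]: "usl2_scale 0 x = 0" "usl2_scale c 0 = 0"
  using usl2_scale_add_left[of 0 0 x] usl2_scale_add_right[of c 0 0] by simp_all

lemma usl2_scale_minus_left: "usl2_scale (- c) x = - usl2_scale c x"
  using usl2_scale_add_left[of c "- c" x] by (simp add: eq_neg_iff_add_eq_0 add.commute)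

lemma usl2_scale_minus_right: "usl2_scale c (- x) = - usl2_scale c x"
  using usl2_scale_add_right[of c x "- x"] by (simp add: eq_neg_iff_add_eq_0 add.commute)

lemma usl2_scale_diff_right: "usl2_scale c (x - y) = usl2_scale c x - usl2_scale c y"
  using usl2_scale_add_right[of c x "- y"] by (simp add: usl2_scale_minus_right)

lemma usl2_scale_sum: "usl2_scale c (sum f S) = (\<Sum>i\<in>S. usl2_scale c (f i))"
  by (induction S rule: infinite_finite_induct) (simp_all add: usl2_scale_add_right)

lemma usl2_scale_sum_left: "usl2_scale (sum f S) x = (\<Sum>i\<in>S. usl2_scale (f i) x)"
  by (induction S rule: infinite_finite_induct) (simp_all add: usl2_scale_add_left)

lemma usl2_of_nat_mult: "of_nat k * x = usl2_scale (of_nat k) x"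
  by (induction k) (simp_all add: usl2_scale_add_left distrib_right)

lemma usl2_scale_numeral: "usl2_scale (numeral n) x = numeral n * x"
  using usl2_of_nat_mult[of "numeral n" x] by simp

lemma usl2_gen_add: "usl2_gen (X + Y) = usl2_gen X + usl2_gen Y"
  by transfer (use env_ideal.rel_add in \<open>simp add: env_rel_def diff_diff_eq\<close>)

lemma usl2_gen_scale: "usl2_gen (sl2_scale c X) = usl2_scale c (usl2_gen X)"
  by transfer (use env_ideal.rel_scale in \<open>simp add: env_rel_def\<close>)

lemma usl2_gen_bracket: "usl2_gen (bracket X Y) = usl2_gen X * usl2_gen Y - usl2_gen Y * usl2_gen X"
  by transfer
    (use env_ideal_uminus[OF env_ideal.rel_bracket] in \<open>simp add: env_rel_def\<close>)

lemma usl2_gen_expansion: "usl2_gen X = (\<Sum>k\<in>UNIV. usl2_scale (sl2_coord X $ k) (usl2_gen (sl2_basis k)))"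
  by (subst sl2_expansion) (simp only: sum_3 usl2_gen_add usl2_gen_scale)

abbreviation "eE \<equiv> usl2_gen sl2_E"
abbreviation "eF \<equiv> usl2_gen sl2_F"
abbreviation "eH \<equiv> usl2_gen sl2_H"

lemma usl2_gen_EFH: "usl2_gen X =
    usl2_scale (sl2_coord X $ 1) eE + usl2_scale (sl2_coord X $ 2) eF + usl2_scale (sl2_coord X $ 3) eH"
  by (subst usl2_gen_expansion) (simp add: sum_3 sl2_basis_def)

lemma abs_usl2_single_Cons:
  "abs_usl2 (Poly_Mapping.single (X # w) c) = usl2_gen X * abs_usl2 (Poly_Mapping.single w c)"
  by (simp add: usl2_gen.abs_eq times_usl2.abs_eq word_gen_def mult_single plus_list_def)

text \<open>
  A spanning principle: every element is a linear combination of monomials in \<open>E, F, H\<close>, built up from the left.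
\<close>

lemma usl2_induct [case_names one add scale E F H]:
  assumes one: "P 1" and add: "\<And>x y. P x \<Longrightarrow> P y \<Longrightarrow> P (x + y)"
    and scale: "\<And>c x. P x \<Longrightarrow> P (usl2_scale c x)"
    and E: "\<And>x. P x \<Longrightarrow> P (eE * x)" and F: "\<And>x. P x \<Longrightarrow> P (eF * x)" and H: "\<And>x. P x \<Longrightarrow> P (eH * x)"
  shows "P u"
proof -
  have zero: "P 0" using scale[OF one, of 0] by simp
  have gen: "P (usl2_gen X * x)" if "P x" for X x
    by (subst usl2_gen_EFH) (simp add: distrib_right usl2_scale_mult_left add scale E F H that)
  have "P (abs_usl2 w)" for w
  proof (induction w rule: poly_mapping_single_induct)
    case zero
    then show ?case using \<open>P 0\<close> by (simp add: zero_usl2_def)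
  next
    case (add x y)
    then show ?case using assms(2) by (simp flip: plus_usl2.abs_eq)
  next
    case (single w c)
    show ?case
    proof (induction w)
      case Nil
      have "abs_usl2 (Poly_Mapping.single [] c) = usl2_scale c 1"
        by (simp add: one_usl2_def usl2_scale.abs_eq word_const_def)
      then show ?case using scale one by simp
    qed (simp add: abs_usl2_single_Cons gen)
  qed
  then show ?thesis by (metis Quotient3_abs_rep Quotient3_usl2)
qed

lemma bracket_basis: "bracket sl2_H sl2_E = sl2_scale 2 sl2_E" "bracket sl2_H sl2_F = sl2_scale (-2) sl2_F"
  "bracket sl2_E sl2_F = sl2_H"
proof -
  have eq: "A = B" if "\<forall>i. sl2_coord A $ i = sl2_coord B $ i" for A B
    using sl2_expansion[of A] sl2_expansion[of B] that by simp
  show "bracket sl2_H sl2_E = sl2_scale 2 sl2_E" "bracket sl2_H sl2_F = sl2_scale (-2) sl2_F"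
    "bracket sl2_E sl2_F = sl2_H"
    by (rule eq; simp add: forall_3 sl2_coord_bracket sl2_coord_linear sl2_coord_basis)+
qed

lemma usl2_HE: "eH * eE = eE * eH + 2 * eE"
  using usl2_gen_bracket[of sl2_H sl2_E]
  by (simp add: bracket_basis usl2_gen_scale usl2_scale_numeral algebra_simps)

lemma usl2_HF: "eH * eF = eF * eH - 2 * eF"
  using usl2_gen_bracket[of sl2_H sl2_F]
  by (simp add: bracket_basis usl2_gen_scale usl2_scale_numeral usl2_scale_minus_left algebra_simps)

lemma usl2_EF: "eE * eF = eF * eE + eH"
  using usl2_gen_bracket[of sl2_E sl2_F] by (simp add: bracket_basis algebra_simps)

section \<open>The action of the enveloping algebra on highest weight modules\<close>

text \<open>
  \<open>env_act\<close> evaluates an element of \<open>U\<close> on a chosen representative in the free algebra. The same sum,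
  taken for an arbitrary element of the free algebra, makes it possible to show that the choice is immaterial.
\<close>

definition word_act :: "complex \<Rightarrow> sl2_words \<Rightarrow> complex poly \<Rightarrow> complex poly" where
  "word_act z x p = (\<Sum>w\<in>Poly_Mapping.keys x. smult (Poly_Mapping.lookup x w) (foldr (verma z) w p))"

lemma verma_add: "verma z A (p + q) = verma z A p + verma z A q"
  and verma_smult: "verma z A (smult c p) = smult c (verma z A p)"
  and verma_plus: "verma z (A + B) p = verma z A p + verma z B p"
  and verma_scale: "verma z (sl2_scale c A) p = smult c (verma z A p)"
  and verma_bracket: "verma z (bracket A B) p = verma z A (verma z B p) - verma z B (verma z A p)"
proof -
  note rep = verma_cyclic_highest_weight[of z, unfolded cyclic_highest_weight_rep_def]
  show "verma z A (p + q) = verma z A p + verma z A q" "verma z A (smult c p) = smult c (verma z A p)"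
    using conjunct1[OF rep] by simp_all
  show "verma z (A + B) p = verma z A p + verma z B p" "verma z (sl2_scale c A) p = smult c (verma z A p)"
    using conjunct1[OF conjunct2[OF rep]] by simp_all
  show "verma z (bracket A B) p = verma z A (verma z B p) - verma z B (verma z A p)"
    using conjunct1[OF conjunct2[OF conjunct2[OF rep]]] by simp
qed

lemma foldr_verma_add: "foldr (verma z) w (p + q) = foldr (verma z) w p + foldr (verma z) w q"
  by (induction w) (simp_all add: verma_add)

lemma foldr_verma_smult: "foldr (verma z) w (smult c p) = smult c (foldr (verma z) w p)"
  by (induction w) (simp_all add: verma_smult)

lemma word_act_superset:
  assumes "finite S" "Poly_Mapping.keys x \<subseteq> S"
  shows "word_act z x p = (\<Sum>w\<in>S. smult (Poly_Mapping.lookup x w) (foldr (verma z) w p))"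
  unfolding word_act_def using assms
  by (intro sum.mono_neutral_left) (auto simp: in_keys_iff)

lemma word_act_add: "word_act z (x + y) p = word_act z x p + word_act z y p"
proof -
  let ?S = "Poly_Mapping.keys x \<union> Poly_Mapping.keys y"
  have "word_act z u p = (\<Sum>w\<in>?S. smult (Poly_Mapping.lookup u w) (foldr (verma z) w p))"
    if "Poly_Mapping.keys u \<subseteq> ?S" for u
    by (rule word_act_superset) (use that in auto)
  then show ?thesis
    using keys_add[of x y] by (simp add: lookup_add smult_add_left sum.distrib)
qed

lemma word_act_single: "word_act z (Poly_Mapping.single w c) p = smult c (foldr (verma z) w p)"
  by (simp add: word_act_superset[where S = "{w}"])

lemma word_act_zero [simp]: "word_act z 0 p = 0"
  by (simp add: word_act_def)

lemma word_act_diff: "word_act z (x - y) p = word_act z x p - word_act z y p"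
  using word_act_add[of z "x - y" y p] by simp

lemma word_act_add_right: "word_act z x (p + q) = word_act z x p + word_act z x q"
  by (simp add: word_act_def foldr_verma_add smult_add_right sum.distrib)

lemma word_act_zero_right [simp]: "word_act z x 0 = 0"
  using word_act_add_right[of z x 0 0] by simp

lemma word_act_smult_right: "word_act z x (smult c p) = smult c (word_act z x p)"
  by (induction x rule: poly_mapping_single_induct)
    (simp_all add: word_act_add word_act_single foldr_verma_smult smult_add_right mult.commute)

lemma word_act_mult: "word_act z (x * y) p = word_act z x (word_act z y p)"
proof (induction x rule: poly_mapping_single_induct)
  case (single w c)
  show ?case
    by (induction y rule: poly_mapping_single_induct)
      (simp_all add: word_act_add word_act_add_right distrib_left mult_single word_act_single
        plus_list_def foldr_verma_smult)
qed (simp_all add: word_act_add distrib_right)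

lemma word_act_gen: "word_act z (word_gen X) p = verma z X p"
  by (simp add: word_gen_def word_act_single)

lemma word_act_const: "word_act z (word_const c) p = smult c p"
  by (simp add: word_const_def word_act_single)

lemma word_act_ideal: "x \<in> env_ideal \<Longrightarrow> word_act z x p = 0"
proof (induction arbitrary: p rule: env_ideal.induct)
  case (rel_add X Y)
  show ?case by (simp add: word_act_diff word_act_gen verma_plus)
next
  case (rel_scale c X)
  show ?case by (simp add: word_act_diff word_act_mult word_act_gen word_act_const verma_scale)
next
  case (rel_bracket X Y)
  show ?case by (simp only: word_act_diff word_act_mult word_act_gen verma_bracket diff_self)
next
  case (add x y)
  then show ?case by (simp add: word_act_add)
next
  case (mult x a b)
  show ?case by (simp add: word_act_mult mult.IH)
qed simp

abbreviation verma_act :: "complex \<Rightarrow> usl2 \<Rightarrow> complex poly \<Rightarrow> complex poly"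
  where "verma_act z \<equiv> env_act smult (verma z)"

text \<open>
  Independence of the representative: two representatives differ by an element of the defining
  ideal, which acts by zero.
\<close>

lemma verma_act_abs: "verma_act z (abs_usl2 x) p = word_act z x p"
proof -
  have "env_rel (rep_usl2 (abs_usl2 x)) x"
    by (rule Quotient3_rep_abs[OF Quotient3_usl2 env_rel_refl])
  then have "word_act z (rep_usl2 (abs_usl2 x) - x) p = 0"
    by (simp add: env_rel_def word_act_ideal)
  then have "word_act z (rep_usl2 (abs_usl2 x)) p = word_act z x p"
    by (simp add: word_act_diff)
  then show ?thesis by (simp add: env_act_def word_act_def)
qed

lemma verma_act_alg:
  shows verma_act_add: "verma_act z (u + v) p = verma_act z u p + verma_act z v p"
    and verma_act_mult: "verma_act z (u * v) p = verma_act z u (verma_act z v p)"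
    and verma_act_scale: "verma_act z (usl2_scale c u) p = smult c (verma_act z u p)"
    and verma_act_gen: "verma_act z (usl2_gen X) p = verma z X p"
    and verma_act_one: "verma_act z 1 p = p"
    and verma_act_zero: "verma_act z 0 p = 0"
    and verma_act_add_right: "verma_act z u (p + q) = verma_act z u p + verma_act z u q"
    and verma_act_smult_right: "verma_act z u (smult c p) = smult c (verma_act z u p)"
proof -
  obtain a b where ab: "u = abs_usl2 a" "v = abs_usl2 b"
    using that Quotient3_abs_rep[OF Quotient3_usl2, symmetric] by blast
  show "verma_act z (u + v) p = verma_act z u p + verma_act z v p"
    "verma_act z (u * v) p = verma_act z u (verma_act z v p)"
    "verma_act z (usl2_scale c u) p = smult c (verma_act z u p)"
    "verma_act z u (p + q) = verma_act z u p + verma_act z u q"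
    "verma_act z u (smult c p) = smult c (verma_act z u p)"
    unfolding ab plus_usl2.abs_eq times_usl2.abs_eq usl2_scale.abs_eq
    by (simp_all add: verma_act_abs word_act_add word_act_mult word_act_const word_act_add_right word_act_smult_right)
  show "verma_act z (usl2_gen X) p = verma z X p" "verma_act z 0 p = 0"
    by (simp_all add: usl2_gen.abs_eq zero_usl2_def verma_act_abs word_act_gen)
  show "verma_act z 1 p = p"
    using word_act_const[of z 1 p] by (simp add: one_usl2_def verma_act_abs word_const_one)
qed

section \<open>The Casimir element and the centralizer of \<open>H\<close>\<close>

text \<open>
  The element \<open>2 * (E * F + F * E) + H\<^sup>2\<close>, written with the raising operator on the right so that its
  value on a highest weight vector can be read off.
\<close>

definition casimir :: usl2 where
  "casimir = 4 * (eF * eE) + eH * eH + 2 * eH"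

lemma usl2_four: "4 * x = 2 * x + 2 * (x :: usl2)"
  using distrib_right[of 2 2 x] by simp

lemma numeral_commute: "numeral n * (x :: 'a :: ring_1) = x * numeral n"
  by (metis mult_of_nat_commute of_nat_numeral)

lemma casimir_FE: "4 * (eF * eE) = casimir - eH * eH - 2 * eH"
  by (simp add: casimir_def)

lemma casimir_EF: "4 * (eE * eF) = casimir - eH * eH + 2 * eH"
  by (simp add: casimir_def usl2_EF distrib_left usl2_four[of eH])

text \<open>
  Both sides are brought to the order \<open>F, E, H\<close> by the three commutation relations. Multiples by
  numerals are written as repeated sums, so that ordinary cancellation of summands finishes the comparison.
\<close>

lemma casimir_commute_gens: "casimir * eE = eE * casimir" "casimir * eF = eF * casimir" "casimir * eH = eH * casimir"
proof -
  have n: "2 * x = x + x" "4 * x = x + x + (x + x)" for x :: usl2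
    by (simp_all add: mult_2 usl2_four)
  have r: "eE * eF = eF * eE + eH" "eH * eE = eE * eH + (eE + eE)" "eH * eF = eF * eH - (eF + eF)"
    by (simp_all add: usl2_EF usl2_HE usl2_HF n)
  have r': "eE * (eF * x) = eF * (eE * x) + eH * x" "eH * (eE * x) = eE * (eH * x) + (eE * x + eE * x)"
    "eH * (eF * x) = eF * (eH * x) - (eF * x + eF * x)" for x
    by (simp_all add: r distrib_right left_diff_distrib flip: mult.assoc)
  show "casimir * eE = eE * casimir" "casimir * eF = eF * casimir" "casimir * eH = eH * casimir"
    unfolding casimir_def n
    by (simp_all add: distrib_left distrib_right left_diff_distrib right_diff_distrib mult.assoc r r')
qed

lemma casimir_commute: "casimir * u = u * casimir"
proof (induction u rule: usl2_induct)
  case (E x) then show ?case by (metis casimir_commute_gens(1) mult.assoc)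
next
  case (F x) then show ?case by (metis casimir_commute_gens(2) mult.assoc)
next
  case (H x) then show ?case by (metis casimir_commute_gens(3) mult.assoc)
qed (simp_all add: distrib_left distrib_right usl2_scale_mult_left usl2_scale_mult_right)

text \<open>
  The value at \<open>casimir\<close> of a polynomial. The coefficients are complex
  numbers while \<open>U\<close> is a noncommutative ring, so the evaluation is written out by Horner's scheme.
\<close>

definition casimir_poly :: "complex poly \<Rightarrow> usl2" where
  "casimir_poly q = fold_coeffs (\<lambda>c u. usl2_scale c 1 + casimir * u) q 0"

text \<open>
  Polynomials in \<open>H\<close> whose coefficients are polynomials in the Casimir element.
\<close>

definition casimir_H_poly :: "complex poly poly \<Rightarrow> usl2" where
  "casimir_H_poly Q = fold_coeffs (\<lambda>q u. casimir_poly q + eH * u) Q 0"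

lemma casimir_poly_0 [simp]: "casimir_poly 0 = 0"
  by (simp add: casimir_poly_def)

lemma casimir_poly_pCons [simp]: "casimir_poly (pCons c q) = usl2_scale c 1 + casimir * casimir_poly q"
  by (cases "q = 0"; cases "c = 0") (simp_all add: casimir_poly_def)

lemma casimir_H_poly_0 [simp]: "casimir_H_poly 0 = 0"
  by (simp add: casimir_H_poly_def)

lemma casimir_H_poly_pCons [simp]: "casimir_H_poly (pCons q Q) = casimir_poly q + eH * casimir_H_poly Q"
  by (cases "Q = 0"; cases "q = 0") (simp_all add: casimir_H_poly_def)

lemma casimir_poly_add: "casimir_poly (p + q) = casimir_poly p + casimir_poly q"
  by (induction p q rule: poly_induct2) (simp_all add: usl2_scale_add_left distrib_left)

lemma casimir_poly_smult: "casimir_poly (smult c p) = usl2_scale c (casimir_poly p)"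
  by (induction p) (simp_all add: usl2_scale_scale usl2_scale_add_right usl2_scale_mult_right)

lemma casimir_H_poly_add: "casimir_H_poly (P + Q) = casimir_H_poly P + casimir_H_poly Q"
  by (induction P Q rule: poly_induct2) (simp_all add: casimir_poly_add distrib_left)

lemma casimir_H_poly_smult_const: "casimir_H_poly (smult [:c:] Q) = usl2_scale c (casimir_H_poly Q)"
  by (induction Q) (simp_all add: casimir_poly_smult usl2_scale_add_right usl2_scale_mult_right)

lemma casimir_H_poly_smult_casimir: "casimir_H_poly (smult [:0, 1:] Q) = casimir * casimir_H_poly Q"
proof (induction Q)
  case (pCons q Q)
  have "eH * (casimir * casimir_H_poly Q) = casimir * (eH * casimir_H_poly Q)"
    by (metis casimir_commute mult.assoc)
  with pCons show ?case by (simp add: distrib_left)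
qed simp

text \<open>
  The commutative subalgebra \<open>\<complex>[casimir, H]\<close>; it turns out to be the centralizer of \<open>H\<close>
  (\<open>commutant_H_weight_zero\<close>), that is, the part of \<open>U\<close> of weight zero.
\<close>

definition weight_zero :: "usl2 set" where
  "weight_zero = range casimir_H_poly"

lemma weight_zero_closed:
  shows weight_zero_add: "a \<in> weight_zero \<Longrightarrow> b \<in> weight_zero \<Longrightarrow> a + b \<in> weight_zero"
    and weight_zero_scale: "a \<in> weight_zero \<Longrightarrow> usl2_scale c a \<in> weight_zero"
    and weight_zero_H: "a \<in> weight_zero \<Longrightarrow> eH * a \<in> weight_zero"
    and weight_zero_casimir: "a \<in> weight_zero \<Longrightarrow> casimir * a \<in> weight_zero"
    and weight_zero_one: "1 \<in> weight_zero"
proof -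
  show "a \<in> weight_zero \<Longrightarrow> b \<in> weight_zero \<Longrightarrow> a + b \<in> weight_zero"
    by (auto simp: weight_zero_def simp flip: casimir_H_poly_add)
  show "a \<in> weight_zero \<Longrightarrow> usl2_scale c a \<in> weight_zero"
    by (auto simp: weight_zero_def simp flip: casimir_H_poly_smult_const)
  show "a \<in> weight_zero \<Longrightarrow> eH * a \<in> weight_zero"
  proof -
    assume "a \<in> weight_zero"
    then obtain Q where "a = casimir_H_poly Q" by (auto simp: weight_zero_def)
    then have "eH * a = casimir_H_poly (pCons 0 Q)" by simp
    then show ?thesis by (simp only: weight_zero_def rangeI)
  qed
  show "a \<in> weight_zero \<Longrightarrow> casimir * a \<in> weight_zero"
    by (auto simp: weight_zero_def simp flip: casimir_H_poly_smult_casimir)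
  have "1 = casimir_H_poly [:[:1:]:]" by simp
  then show "1 \<in> weight_zero" unfolding weight_zero_def by (metis rangeI)
qed

lemma weight_zero_commutes_H: "a \<in> weight_zero \<Longrightarrow> eH * a = a * eH"
proof -
  have c: "casimir_poly q * u = u * casimir_poly q" for q u
  proof (induction q)
    case (pCons c q)
    have "casimir * casimir_poly q * u = u * (casimir * casimir_poly q)"
      by (metis casimir_commute mult.assoc pCons.IH)
    then show ?case
      by (simp add: distrib_left distrib_right usl2_scale_mult_left usl2_scale_mult_right)
  qed simp
  have "eH * casimir_H_poly Q = casimir_H_poly Q * eH" for Q
  proof (induction Q)
    case (pCons q Q)
    have "eH * (eH * casimir_H_poly Q) = eH * casimir_H_poly Q * eH"
      by (metis pCons.IH mult.assoc)
    then show ?case by (simp add: distrib_left distrib_right c)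
  qed simp
  then show "a \<in> weight_zero \<Longrightarrow> eH * a = a * eH" by (auto simp: weight_zero_def)
qed

lemma H_power_E: "eH * eE ^ m = eE ^ m * (eH + of_nat (2 * m))"
proof (induction m)
  case (Suc m)
  have "eH * eE ^ Suc m = (eE * eH + 2 * eE) * eE ^ m" by (simp add: usl2_HE flip: mult.assoc)
  also have "\<dots> = eE * (eH * eE ^ m) + eE ^ Suc m * 2"
    by (simp add: distrib_right mult.assoc numeral_commute)
  finally show ?case by (simp add: Suc mult_2_right algebra_simps)
qed simp

lemma H_power_F: "eH * eF ^ m = eF ^ m * (eH - of_nat (2 * m))"
proof (induction m)
  case (Suc m)
  have "eH * eF ^ Suc m = (eF * eH - 2 * eF) * eF ^ m" by (simp add: usl2_HF flip: mult.assoc)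
  also have "\<dots> = eF * (eH * eF ^ m) - eF ^ Suc m * 2"
    by (simp add: left_diff_distrib mult.assoc numeral_commute)
  finally show ?case by (simp add: Suc mult_2_right algebra_simps)
qed simp


text \<open>
  Sums of elements of the weight spaces \<open>E ^ m * \<complex>[casimir, H]\<close> and \<open>F ^ m * \<complex>[casimir, H]\<close>.
\<close>

inductive_set weight_sums :: "usl2 set" where
  E: "a \<in> weight_zero \<Longrightarrow> eE ^ m * a \<in> weight_sums"
| F: "a \<in> weight_zero \<Longrightarrow> eF ^ m * a \<in> weight_sums"
| add: "x \<in> weight_sums \<Longrightarrow> y \<in> weight_sums \<Longrightarrow> x + y \<in> weight_sums"

lemma H_mult_power:
  shows H_mult_E_power: "eH * (eE ^ m * a) = eE ^ m * (eH * a + usl2_scale (of_nat (2 * m)) a)"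
    and H_mult_F_power: "eH * (eF ^ m * a) = eF ^ m * (eH * a - usl2_scale (of_nat (2 * m)) a)"
  by (simp_all only: mult.assoc[symmetric] H_power_E H_power_F)
    (simp_all only: mult.assoc distrib_right left_diff_distrib usl2_of_nat_mult)

lemma weight_zero_diff:
  assumes "a \<in> weight_zero" "b \<in> weight_zero"
  shows "a - b \<in> weight_zero"
  using weight_zero_add[OF assms(1) weight_zero_scale[OF assms(2), of "-1"]]
  by (simp add: usl2_scale_minus_left)

lemma usl2_scale_quarter: "usl2_scale (1 / 4) (4 * x) = x"
  by (simp add: usl2_scale_scale flip: usl2_scale_numeral)

text \<open>
  The weight sums are closed under left multiplication by the generators. The only cases that need an
  argument are \<open>E\<close> against a power of \<open>F\<close> and vice versa: one of the factors \<open>E * F\<close> or \<open>F * E\<close> is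
  replaced by a quadratic polynomial in \<open>H\<close> and the Casimir element, and this polynomial is then moved to the right
  across the remaining powers, which only shifts \<open>H\<close>.
\<close>

lemma weight_sums_UNIV: "u \<in> weight_sums"
proof (induction u rule: usl2_induct)
  case one
  show ?case using weight_sums.E[OF weight_zero_one, of 0] by simp
next
  case (add x y)
  then show ?case by (rule weight_sums.add)
next
  case (scale c x)
  then show ?case
    by induction (simp_all add: weight_sums.intros weight_zero_scale usl2_scale_add_right
        flip: usl2_scale_mult_right)
next
  case (H x)
  then show ?case
    by induction (simp_all add: H_mult_power weight_sums.intros weight_zero_add
        weight_zero_diff weight_zero_scale weight_zero_H distrib_left del: of_nat_mult)
next
  case (E x)
  then show ?case
  proof induction
    case (E a m)
    then show ?case using weight_sums.E[of a "Suc m"] by (simp add: mult.assoc)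
  next
    case (F a m)
    show ?case
    proof (cases m)
      case 0
      then show ?thesis using weight_sums.E[OF F, of 1] by simp
    next
      case (Suc k)
      \<comment> \<open>what multiplication by \<open>H\<close> becomes to the right of \<open>F ^ k\<close>\<close>
      define shift where "shift b = eH * b - usl2_scale (of_nat (2 * k)) b" for b
      have shift: "shift b \<in> weight_zero" if "b \<in> weight_zero" for b
        using that by (simp add: shift_def weight_zero_diff weight_zero_scale weight_zero_H del: of_nat_mult)
      have "4 * (eE * (eF ^ m * a)) = (casimir - eH * eH + 2 * eH) * (eF ^ k * a)"
        by (simp add: Suc mult.assoc flip: casimir_EF)
      also have "\<dots> = casimir * (eF ^ k * a) - eH * (eH * (eF ^ k * a)) + usl2_scale 2 (eH * (eF ^ k * a))"
        by (simp add: distrib_right left_diff_distrib mult.assoc usl2_scale_numeral)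
      also have "\<dots> = eF ^ k * (casimir * a - shift (shift a) + usl2_scale 2 (shift a))"
        unfolding H_mult_F_power shift_def[symmetric]
        by (simp add: distrib_left right_diff_distrib usl2_scale_mult_right)
          (metis casimir_commute mult.assoc)
      finally have "eE * (eF ^ m * a) = eF ^ k * usl2_scale (1 / 4) (casimir * a - shift (shift a) + usl2_scale 2 (shift a))"
        by (metis usl2_scale_quarter usl2_scale_mult_right)
      then show ?thesis
        by (simp add: weight_sums.F F shift weight_zero_scale weight_zero_add
            weight_zero_diff weight_zero_casimir)
    qed
  qed (simp add: distrib_left weight_sums.add)
next
  case (F x)
  then show ?case
  proof induction
    case (F a m)
    then show ?case using weight_sums.F[of a "Suc m"] by (simp add: mult.assoc)
  next
    case (E a m)
    show ?case
    proof (cases m)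
      case 0
      then show ?thesis using weight_sums.F[OF E, of 1] by simp
    next
      case (Suc k)
      \<comment> \<open>what multiplication by \<open>H\<close> becomes to the right of \<open>E ^ k\<close>\<close>
      define shift where "shift b = eH * b + usl2_scale (of_nat (2 * k)) b" for b
      have shift: "shift b \<in> weight_zero" if "b \<in> weight_zero" for b
        using that by (simp add: shift_def weight_zero_add weight_zero_scale weight_zero_H del: of_nat_mult)
      have "4 * (eF * (eE ^ m * a)) = (casimir - eH * eH - 2 * eH) * (eE ^ k * a)"
        by (simp add: Suc mult.assoc flip: casimir_FE)
      also have "\<dots> = casimir * (eE ^ k * a) - eH * (eH * (eE ^ k * a)) - usl2_scale 2 (eH * (eE ^ k * a))"
        by (simp add: left_diff_distrib mult.assoc usl2_scale_numeral)
      also have "\<dots> = eE ^ k * (casimir * a - shift (shift a) - usl2_scale 2 (shift a))"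
        unfolding H_mult_E_power shift_def[symmetric]
        by (simp add: right_diff_distrib usl2_scale_mult_right)
          (metis casimir_commute mult.assoc)
      finally have "eF * (eE ^ m * a) = eE ^ k * usl2_scale (1 / 4) (casimir * a - shift (shift a) - usl2_scale 2 (shift a))"
        by (metis usl2_scale_quarter usl2_scale_mult_right)
      then show ?thesis
        by (simp add: weight_sums.E E shift weight_zero_scale
            weight_zero_diff weight_zero_casimir)
    qed
  qed (simp add: distrib_left weight_sums.add)
qed

text \<open>
  The operator \<open>ad H - \<mu>\<close>. A product of such operators over the nonzero weights that occur in an element
  annihilates all its components except the one of weight zero.
\<close>

definition ad_H_shift :: "complex \<Rightarrow> usl2 \<Rightarrow> usl2" where
  "ad_H_shift \<mu> x = eH * x - x * eH - usl2_scale \<mu> x"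

lemma ad_H_shift_add: "ad_H_shift \<mu> (x + y) = ad_H_shift \<mu> x + ad_H_shift \<mu> y"
  by (simp add: ad_H_shift_def distrib_left distrib_right usl2_scale_add_right)

lemma ad_H_shift_zero: "ad_H_shift \<mu> 0 = 0"
  by (simp add: ad_H_shift_def)

lemma ad_H_shift_commute: "ad_H_shift \<mu> (ad_H_shift \<nu> x) = ad_H_shift \<nu> (ad_H_shift \<mu> x)"
  by (simp add: ad_H_shift_def left_diff_distrib right_diff_distrib usl2_scale_diff_right
      usl2_scale_mult_left usl2_scale_mult_right usl2_scale_scale mult.commute[of \<mu>])

lemma foldr_ad_H_shift:
  shows foldr_ad_H_shift_add: "foldr ad_H_shift L (x + y) = foldr ad_H_shift L x + foldr ad_H_shift L y"
    and foldr_ad_H_shift_zero: "foldr ad_H_shift L 0 = 0"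
    and foldr_ad_H_shift_commute1: "foldr ad_H_shift L (ad_H_shift \<mu> x) = ad_H_shift \<mu> (foldr ad_H_shift L x)"
    and foldr_ad_H_shift_weight_zero: "eH * x = x * eH \<Longrightarrow>
      foldr ad_H_shift L x = usl2_scale (\<Prod>\<mu>\<leftarrow>L. - \<mu>) x"
proof -
  show "eH * x = x * eH \<Longrightarrow> foldr ad_H_shift L x = usl2_scale (\<Prod>\<mu>\<leftarrow>L. - \<mu>) x"
    by (induction L)
      (simp_all add: ad_H_shift_def usl2_scale_mult_left usl2_scale_mult_right usl2_scale_scale usl2_scale_minus_left)
qed (induction L; simp add: ad_H_shift_add ad_H_shift_zero ad_H_shift_commute)+

lemma foldr_ad_H_shift_commute:
  "foldr ad_H_shift L (foldr ad_H_shift L' x) = foldr ad_H_shift L' (foldr ad_H_shift L x)"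
  by (induction L) (simp_all add: foldr_ad_H_shift_commute1)

text \<open>
  Every element of \<open>U\<close> differs from one in \<open>\<complex>[casimir, H]\<close> by components of nonzero weight. These are
  recorded by the list of their weights, through the operators that annihilate them.
\<close>

lemma weight_zero_component:
  "\<exists>a\<in>weight_zero. \<exists>L. 0 \<notin> set L \<and> foldr ad_H_shift L (u - a) = 0"
  using weight_sums_UNIV[of u]
proof (induction rule: weight_sums.induct)
  case (E a m)
  show ?case
  proof (cases "m = 0")
    case False
    have "ad_H_shift (of_nat (2 * m)) (eE ^ m * a) = 0"
      unfolding ad_H_shift_def H_mult_E_power
      by (simp add: distrib_left weight_zero_commutes_H[OF E] mult.assoc usl2_scale_mult_right)
    then show ?thesis
      using False weight_zero_diff[OF E E]
      by (intro bexI[of _ 0] exI[of _ "[of_nat (2 * m)]"]) (simp_all del: of_nat_mult)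
  qed (use E in \<open>auto intro!: bexI[of _ a] exI[of _ "[]"]\<close>)
next
  case (F a m)
  show ?case
  proof (cases "m = 0")
    case False
    have "ad_H_shift (- of_nat (2 * m)) (eF ^ m * a) = 0"
      unfolding ad_H_shift_def H_mult_F_power
      by (simp add: right_diff_distrib weight_zero_commutes_H[OF F] mult.assoc usl2_scale_mult_right usl2_scale_minus_left)
    then show ?thesis
      using False weight_zero_diff[OF F F]
      by (intro bexI[of _ 0] exI[of _ "[- of_nat (2 * m)]"]) (simp_all del: of_nat_mult)
  qed (use F in \<open>auto intro!: bexI[of _ a] exI[of _ "[]"]\<close>)
next
  case (add x y)
  then obtain a b K L where "a \<in> weight_zero" "b \<in> weight_zero" "0 \<notin> set K" "0 \<notin> set L"
    and kill: "foldr ad_H_shift K (x - a) = 0" "foldr ad_H_shift L (y - b) = 0"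
    by auto
  moreover have "foldr ad_H_shift (K @ L) ((x - a) + (y - b)) = 0"
    unfolding foldr_ad_H_shift_add foldr_append kill(2) foldr_ad_H_shift_commute[of K L] kill(1)
    by (simp add: foldr_ad_H_shift_zero)
  ultimately show ?case
    by (intro bexI[of _ "a + b"] exI[of _ "K @ L"]) (simp_all add: weight_zero_add add_diff_add)
qed

text \<open>
  On an element commuting with \<open>H\<close> the operator \<open>ad H - \<mu>\<close> is multiplication by \<open>- \<mu>\<close>. The
  product of these operators that kills \<open>u - a\<close> is therefore multiplication by a nonzero scalar, so \<open>u = a\<close>.
\<close>

lemma commutant_H_weight_zero:
  assumes "eH * u = u * eH"
  shows "u \<in> weight_zero"
proof -
  obtain a L where a: "a \<in> weight_zero" and L: "0 \<notin> set L" "foldr ad_H_shift L (u - a) = 0"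
    using weight_zero_component by blast
  have "eH * (u - a) = (u - a) * eH"
    using assms weight_zero_commutes_H[OF a] by (simp add: left_diff_distrib right_diff_distrib)
  then have "usl2_scale (\<Prod>\<mu>\<leftarrow>L. - \<mu>) (u - a) = 0"
    using L(2) by (simp add: foldr_ad_H_shift_weight_zero)
  moreover have nz: "(\<Prod>\<mu>\<leftarrow>L. - \<mu>) \<noteq> 0"
    using L(1) by (auto simp: prod_list_zero_iff)
  ultimately have "usl2_scale (inverse (\<Prod>\<mu>\<leftarrow>L. - \<mu>) * (\<Prod>\<mu>\<leftarrow>L. - \<mu>)) (u - a) = 0"
    by (simp only: usl2_scale_scale[symmetric] usl2_scale_zero)
  then have "u = a" using nz by simp
  then show ?thesis using a by simp
qed

section \<open>The centre and its characters\<close>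

lemma verma_gens:
  "verma z sl2_E p = verma_E z p" "verma z sl2_F p = verma_F p" "verma z sl2_H p = verma_H z p"
  by (simp_all add: verma_def sl2_coord_basis)

lemma verma_act_numeral: "verma_act z (numeral n * x) p = smult (numeral n) (verma_act z x p)"
  by (simp add: verma_act_scale flip: usl2_scale_numeral)

text \<open>
  The module is generated by \<open>1\<close> under \<open>F\<close>.
\<close>

lemma verma_act_commutes_F:
  assumes "u * eF = eF * u" "verma_act z u 1 = smult \<mu> 1"
  shows "verma_act z u p = smult \<mu> p"
proof (induction p)
  case 0
  show ?case using verma_act_smult_right[of z u 0 0] by simp
next
  case (pCons a p)
  have eq: "pCons a p = smult a 1 + verma_act z eF p"
    by (simp add: verma_act_gen verma_gens verma_F_def)
  have "verma_act z u (verma_act z eF p) = smult \<mu> (verma_act z eF p)"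
    by (metis assms(1) pCons.IH verma_act_mult verma_act_smult_right)
  then show ?case
    unfolding eq by (simp only: verma_act_add_right verma_act_smult_right assms(2) smult_add_right smult_smult mult.commute)
qed

lemma verma_act_casimir: "verma_act z casimir p = smult (4 * z * (z + 1)) p"
proof (rule verma_act_commutes_F)
  show "verma_act z casimir 1 = smult (4 * z * (z + 1)) 1"
    unfolding casimir_def verma_act_add verma_act_numeral
    by (simp add: verma_act_mult verma_act_gen verma_gens verma_E_def verma_F_def verma_H_def
        pderiv_smult algebra_simps)
qed (rule casimir_commute)

lemma verma_act_casimir_poly: "verma_act z (casimir_poly q) p = smult (poly q (4 * z * (z + 1))) p"
  by (induction q) (simp_all only: casimir_poly_0 casimir_poly_pCons verma_act_add verma_act_mult verma_act_scale verma_act_one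
      verma_act_zero verma_act_casimir poly_0 poly_pCons smult_0_left smult_add_left smult_smult)

lemma verma_H_monom: "verma z sl2_H (monom 1 k) = smult (2 * z - 2 * of_nat k) (monom 1 k)"
  by (intro poly_eqI)
    (auto simp: verma_gens verma_H_def coeff_pCons coeff_pderiv left_diff_distrib split: nat.split)

lemma verma_act_casimir_H_poly:
  "verma_act z (casimir_H_poly Q) (monom 1 k) =
    smult (poly (map_poly (\<lambda>q. poly q (4 * z * (z + 1))) Q) (2 * z - 2 * of_nat k)) (monom 1 k)"
proof (induction Q)
  case (pCons q Q)
  then show ?case
    by (simp only: casimir_H_poly_pCons verma_act_add verma_act_mult verma_act_gen verma_act_casimir_poly verma_act_smult_right
        verma_smult verma_H_monom map_poly_pCons poly_0 poly_pCons smult_add_left smult_smult)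
      (simp add: mult.commute)
qed (simp add: verma_act_zero)

text \<open>
  The equation is \<open>(2 * z + 1)\<^sup>2 = w + 1\<close>; \<open>s\<close> stands for \<open>2 * z + 1\<close>.
\<close>

lemma casimir_value_surj: "\<exists>z. 4 * z * (z + 1) = (w :: complex)"
proof
  define s where "s = csqrt (1 + w)"
  have "s ^ 2 = 1 + w" by (simp add: s_def)
  moreover have "4 * ((s - 1) / 2) * ((s - 1) / 2 + 1) = s ^ 2 - 1"
    by (simp add: field_simps power2_eq_square)
  ultimately show "4 * ((s - 1) / 2) * ((s - 1) / 2 + 1) = w" by simp
qed

lemma poly_const_on_infinite:
  fixes p :: "complex poly"
  assumes "\<And>k :: nat. poly p (a - 2 * of_nat k) = c"
  shows "p = [:c:]"
proof (rule ccontr)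
  assume "p \<noteq> [:c:]"
  then have "finite {x. poly (p - [:c:]) x = 0}" by (intro poly_roots_finite) simp
  moreover have "range (\<lambda>k :: nat. a - 2 * of_nat k) \<subseteq> {x. poly (p - [:c:]) x = 0}"
    using assms by auto
  moreover have "infinite (range (\<lambda>k :: nat. a - 2 * of_nat k))"
    by (rule range_inj_infinite) (simp add: inj_def)
  ultimately show False using finite_subset by blast
qed

text \<open>
  A central \<open>u\<close> is a polynomial \<open>Q\<close> in \<open>H\<close> over \<open>\<complex>[casimir]\<close> because it commutes with \<open>H\<close>. On the
  highest weight module of weight \<open>2 * z\<close> it acts on \<open>F\<^sup>k v\<^sub>0\<close> by the value at \<open>2 * z - 2 * k\<close> of the
  polynomial \<open>P\<close> obtained by specialising the Casimir element to \<open>4 * z * (z + 1)\<close>. As \<open>u\<close> acts by a scalar, \<open>P\<close>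
  is constant; and since the Casimir value is arbitrary, the higher coefficients of \<open>Q\<close> vanishift identically.
\<close>

lemma centre_casimir_poly:
  assumes "u \<in> usl2_centre"
  obtains q where "u = casimir_poly q"
proof -
  have comm: "u * x = x * u" for x
    using assms by (simp add: usl2_centre_def)
  obtain Q where Q: "u = casimir_H_poly Q"
    using commutant_H_weight_zero[of u] comm[of eH] unfolding weight_zero_def by auto
  have "coeff Q (Suc j) = 0" for j
  proof -
    have "poly (coeff Q (Suc j)) w = 0" for w
    proof -
      obtain z where z: "4 * z * (z + 1) = w" using casimir_value_surj by blast
      define P where "P = map_poly (\<lambda>q. poly q w) Q"
      have act: "verma_act z u (monom 1 k) = smult (poly P (2 * z - 2 * of_nat k)) (monom 1 k)" for k
        unfolding P_def z[symmetric] Q by (rule verma_act_casimir_H_poly)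
      have "verma_act z u 1 = smult (poly P (2 * z)) 1"
        using act[of 0] by simp
      then have scalar: "verma_act z u p = smult (poly P (2 * z)) p" for p
        using verma_act_commutes_F comm by blast
      have "poly P (2 * z - 2 * of_nat k) = poly P (2 * z)" for k
        using arg_cong[OF act[of k, unfolded scalar], of "\<lambda>p. coeff p k"] by simp
      then have "P = [:poly P (2 * z):]" by (rule poly_const_on_infinite)
      then have "coeff P (Suc j) = 0" by (metis coeff_pCons_Suc coeff_0)
      then show ?thesis by (simp add: P_def coeff_map_poly)
    qed
    then show ?thesis using poly_all_0_iff_0 by blast
  qed
  then have "Q = [:coeff Q 0:]"
    by (intro poly_eqI) (simp add: coeff_pCons split: nat.split)
  then have "u = casimir_poly (coeff Q 0)"
    unfolding Q by (metis add.right_neutral casimir_H_poly_0 casimir_H_poly_pCons mult_zero_right)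
  then show ?thesis by (rule that)
qed

lemma central_character_eqI:
  assumes "\<And>p. verma_act z u p = smult \<mu> p"
  shows "central_character z u = \<mu>"
  unfolding central_character_def
proof (rule the_equality)
  fix \<nu> assume "\<forall>p. verma_act z u p = smult \<nu> p"
  then have "smult \<nu> 1 = smult \<mu> (1 :: complex poly)" using assms by metis
  then show "\<nu> = \<mu>" by (simp add: smult_one)
qed (use assms in blast)

lemma usl2_centre_casimir: "casimir \<in> usl2_centre"
  by (simp add: usl2_centre_def casimir_commute)

lemma usl2_centre_closed:
  shows usl2_centre_add: "a \<in> usl2_centre \<Longrightarrow> b \<in> usl2_centre \<Longrightarrow> a + b \<in> usl2_centre"
    and usl2_centre_scale: "a \<in> usl2_centre \<Longrightarrow> usl2_scale c a \<in> usl2_centre"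
    and usl2_centre_one: "1 \<in> usl2_centre"
    and usl2_centre_mult: "a \<in> usl2_centre \<Longrightarrow> b \<in> usl2_centre \<Longrightarrow> a * b \<in> usl2_centre"
proof -
  show "a + b \<in> usl2_centre" if "a \<in> usl2_centre" "b \<in> usl2_centre"
    using that by (auto simp: usl2_centre_def distrib_left distrib_right)
  show "usl2_scale c a \<in> usl2_centre" if "a \<in> usl2_centre"
    using that by (auto simp: usl2_centre_def usl2_scale_mult_left usl2_scale_mult_right)
  show "1 \<in> usl2_centre" by (simp add: usl2_centre_def)
  show "a * b \<in> usl2_centre" if "a \<in> usl2_centre" "b \<in> usl2_centre"
  proof -
    have comm: "a * y = y * a" "b * y = y * b" for y
      using that by (auto simp: usl2_centre_def)
    have "a * b * x = x * (a * b)" for x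
      by (metis comm mult.assoc)
    then show ?thesis by (simp add: usl2_centre_def)
  qed
qed

lemma usl2_centre_casimir_poly: "casimir_poly q \<in> usl2_centre"
proof (induction q)
  case 0
  show ?case by (simp add: usl2_centre_def)
qed (simp add: usl2_centre_closed usl2_centre_casimir)

lemma morphism_on_centre:
  assumes "algebra_morphism_on_centre ch"
  shows morphism_one: "ch 1 = 1"
    and morphism_add: "a \<in> usl2_centre \<Longrightarrow> b \<in> usl2_centre \<Longrightarrow> ch (a + b) = ch a + ch b"
    and morphism_mult: "a \<in> usl2_centre \<Longrightarrow> b \<in> usl2_centre \<Longrightarrow> ch (a * b) = ch a * ch b"
    and morphism_scale: "a \<in> usl2_centre \<Longrightarrow> ch (usl2_scale c a) = c * ch a"
  using assms by (simp_all add: algebra_morphism_on_centre_def)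

lemma morphism_casimir_poly:
  assumes "algebra_morphism_on_centre ch"
  shows "ch (casimir_poly q) = poly q (ch casimir)"
proof (induction q)
  case 0
  show ?case using morphism_scale[OF assms usl2_centre_one, of 0] by simp
next
  case (pCons c q)
  then show ?case
    by (simp add: morphism_on_centre[OF assms] usl2_centre_closed usl2_centre_casimir usl2_centre_casimir_poly)
qed

lemma central_character_casimir_poly: "central_character z (casimir_poly q) = poly q (4 * z * (z + 1))"
  by (rule central_character_eqI) (rule verma_act_casimir_poly)

lemma verma_act_centre:
  assumes "u \<in> usl2_centre"
  shows "verma_act z u p = smult (central_character z u) p"
  using centre_casimir_poly[OF assms] by (metis verma_act_casimir_poly central_character_casimir_poly)

text \<open>
  Both characters are determined by their values at the Casimir element, and \<open>z\<close> is chosen to make these agree.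
\<close>

theorem morphism_is_central_character:
  assumes "algebra_morphism_on_centre ch"
  shows "\<exists>z. \<forall>u\<in>usl2_centre. ch u = central_character z u"
proof -
  obtain z where z: "4 * z * (z + 1) = ch casimir" using casimir_value_surj by blast
  have "ch u = central_character z u" if u: "u \<in> usl2_centre" for u
  proof -
    obtain q where "u = casimir_poly q" using centre_casimir_poly[OF u] .
    then show ?thesis
      by (simp only: morphism_casimir_poly[OF assms] central_character_casimir_poly z)
  qed
  then show ?thesis by blast
qed

section \<open>Commutators with the universal weight system\<close>

lemma tensor_ad_nth:
  "tensor_ad X t $ k $ l = (\<Sum>p\<in>UNIV. t $ fst p $ snd p *
    (sl2_coord (bracket X (sl2_basis (fst p))) $ k * sl2_coord (sl2_basis (snd p)) $ l
     + sl2_coord (sl2_basis (fst p)) $ k * sl2_coord (bracket X (sl2_basis (snd p))) $ l))"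
  by (simp add: tensor_ad_def tensor_scale_def tensor_def sum.cartesian_product UNIV_Times_UNIV[symmetric]
      case_prod_beta del: UNIV_Times_UNIV)

text \<open>
  The form in which invariance of the tensor is used: contracting \<open>t\<close> with any bilinear map kills
  the sum of the two derivatives, here a map into \<open>U\<close> that inserts two elements in fixed places of a product.
\<close>

lemma invariant_contraction:
  assumes t: "infinitesimal_R_matrix t"
    and lin1: "\<And>A B. f A B = (\<Sum>k\<in>UNIV. usl2_scale (sl2_coord A $ k) (f (sl2_basis k) B))"
    and lin2: "\<And>A B. f A B = (\<Sum>k\<in>UNIV. usl2_scale (sl2_coord B $ k) (f A (sl2_basis k)))"
  shows "(\<Sum>p\<in>UNIV. usl2_scale (t $ fst p $ snd p)
    (f (bracket X (sl2_basis (fst p))) (sl2_basis (snd p)) + f (sl2_basis (fst p)) (bracket X (sl2_basis (snd p))))) = 0"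
proof -
  let ?e = "\<lambda>q :: 3 \<times> 3. f (sl2_basis (fst q)) (sl2_basis (snd q))"
  have bilin: "f A B = (\<Sum>q\<in>UNIV. usl2_scale (sl2_coord A $ fst q * sl2_coord B $ snd q) (?e q))" for A B
  proof -
    have "f A B = (\<Sum>k\<in>UNIV. usl2_scale (sl2_coord A $ k)
        (\<Sum>l\<in>UNIV. usl2_scale (sl2_coord B $ l) (f (sl2_basis k) (sl2_basis l))))"
      by (subst lin1, subst lin2) (rule refl)
    then show ?thesis
      by (simp add: usl2_scale_sum usl2_scale_scale sum.cartesian_product case_prod_beta)
  qed
  let ?c = "\<lambda>p q. sl2_coord (bracket X (sl2_basis (fst p))) $ fst q * sl2_coord (sl2_basis (snd p)) $ snd q
     + sl2_coord (sl2_basis (fst p)) $ fst q * sl2_coord (bracket X (sl2_basis (snd p))) $ snd q"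
  have "(\<Sum>p\<in>UNIV. usl2_scale (t $ fst p $ snd p)
      (f (bracket X (sl2_basis (fst p))) (sl2_basis (snd p)) + f (sl2_basis (fst p)) (bracket X (sl2_basis (snd p)))))
    = (\<Sum>p\<in>UNIV. \<Sum>q\<in>UNIV. usl2_scale (t $ fst p $ snd p * ?c p q) (?e q))"
    by (subst (1 2) bilin)
      (simp only: usl2_scale_sum sum.distrib[symmetric] usl2_scale_add_left[symmetric] usl2_scale_scale)
  also have "\<dots> = (\<Sum>q\<in>UNIV. usl2_scale (tensor_ad X t $ fst q $ snd q) (?e q))"
    by (subst sum.swap) (simp only: tensor_ad_nth usl2_scale_sum_left)
  also have "\<dots> = 0"
    using t by (simp add: infinitesimal_R_matrix_def)
  finally show ?thesis .
qed

text \<open>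
  The Leibniz rule for the derivation \<open>[x, -]\<close>. The list is required to be distinct so that a position
  can be addressed by its entry and the altered factor written as a function update.
\<close>

lemma commutator_prod_list:
  fixes x :: "'a :: ring_1"
  assumes "distinct ts"
  shows "x * prod_list (map f ts) - prod_list (map f ts) * x =
    (\<Sum>s\<in>set ts. prod_list (map (f(s := x * f s - f s * x)) ts))"
  using assms
proof (induction ts)
  case (Cons s ts)
  define g where "g r = f(r := x * f r - f r * x)" for r
  have "prod_list (map (g s) (s # ts)) = (x * f s - f s * x) * prod_list (map f ts)"
    using Cons.prems by (simp add: g_def)
  moreover have "(\<Sum>r\<in>set ts. prod_list (map (g r) (s # ts))) = (\<Sum>r\<in>set ts. f s * prod_list (map (g r) ts))"
    using Cons.prems by (intro sum.cong) (auto simp: g_def)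
  moreover have "\<dots> = f s * (x * prod_list (map f ts) - prod_list (map f ts) * x)"
    using Cons.prems by (subst Cons.IH) (simp_all add: g_def sum_distrib_left)
  ultimately have "(\<Sum>r\<in>set (s # ts). prod_list (map (g r) (s # ts))) =
      (x * f s - f s * x) * prod_list (map f ts) + f s * (x * prod_list (map f ts) - prod_list (map f ts) * x)"
    using Cons.prems by simp
  also have "\<dots> = x * prod_list (map f (s # ts)) - prod_list (map f (s # ts)) * x"
    by (simp add: left_diff_distrib right_diff_distrib mult.assoc)
  finally show ?case by (simp only: g_def)
qed simp

lemma prod_list_one_factor:
  assumes "distinct ts" "s \<in> set ts"
  obtains a b where "\<And>y. prod_list (map (f(s := y)) ts) = a * y * (b :: 'a :: monoid_mult)"
proof -
  obtain us vs where ts: "ts = us @ s # vs" using assms(2) by (meson split_list)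
  have "prod_list (map (f(s := y)) ts) = prod_list (map f us) * y * prod_list (map f vs)" for y
    using assms(1) by (simp add: ts mult.assoc)
  then show ?thesis by (rule that)
qed

lemma prod_list_linear_factor:
  assumes "distinct ts" "s \<in> set ts"
  shows "prod_list (map (f(s := usl2_gen A)) ts) =
    (\<Sum>k\<in>UNIV. usl2_scale (sl2_coord A $ k) (prod_list (map (f(s := usl2_gen (sl2_basis k))) ts)))"
proof -
  obtain a b where ab: "\<And>y. prod_list (map (f(s := y)) ts) = a * y * b"
    using prod_list_one_factor[OF assms, of f] by metis
  show ?thesis
    unfolding ab by (subst usl2_gen_expansion)
      (simp add: sum_distrib_left sum_distrib_right usl2_scale_mult_left usl2_scale_mult_right)
qed

text \<open>
  This isolates the sum over the label of a single chord, to which the invariance of the tensor applies.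
\<close>

lemma sum_PiE_split:
  assumes "c \<in> D"
  shows "(\<Sum>\<iota>\<in>(\<Pi>\<^sub>E c\<in>D. UNIV). g \<iota>) = (\<Sum>\<kappa>\<in>(\<Pi>\<^sub>E c\<in>D - {c}. UNIV). \<Sum>p\<in>UNIV. g (\<kappa>(c := p)))"
proof -
  let ?S = "UNIV \<times> (\<Pi>\<^sub>E c\<in>D - {c}. UNIV)"
  have D: "D = insert c (D - {c})" using assms by blast
  have "(\<Sum>\<iota>\<in>(\<Pi>\<^sub>E c\<in>D. UNIV). g \<iota>) = (\<Sum>\<iota>\<in>(\<lambda>(y, \<kappa>). \<kappa>(c := y)) ` ?S. g \<iota>)"
    by (subst D, subst PiE_insert_eq) simp
  also have "\<dots> = (\<Sum>(y, \<kappa>)\<in>?S. g (\<kappa>(c := y)))"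
    by (subst sum.reindex) (simp_all add: inj_combinator[of c "D - {c}" "\<lambda>_. UNIV"] case_prod_beta)
  also have "\<dots> = (\<Sum>\<kappa>\<in>(\<Pi>\<^sub>E c\<in>D - {c}. UNIV). \<Sum>p\<in>UNIV. g (\<kappa>(c := p)))"
    by (subst sum.cartesian_product[symmetric], subst sum.swap) (rule refl)
  finally show ?thesis .
qed

lemma inj_on_Arg2pi_sphere: "inj_on Arg2pi (sphere 0 1)"
  by (metis cis_Arg2pi inj_on_inverseI)

text \<open>
  The minimum and maximum of the angles are the parameters at which the chord is met first and
  second from the base point.
\<close>

lemma chord_angles:
  assumes D: "chord_set D" and c: "c \<in> D"
  defines "\<alpha> \<equiv> Min (Arg2pi ` c)" and "\<beta> \<equiv> Max (Arg2pi ` c)"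
  shows "Arg2pi ` c = {\<alpha>, \<beta>}" "\<alpha> \<noteq> \<beta>"
proof -
  have sub: "c \<subseteq> sphere 0 1" and "card c = 2" using D c by (auto simp: chord_set_def)
  then have "card (Arg2pi ` c) = 2"
    using inj_on_subset[OF inj_on_Arg2pi_sphere sub] by (simp add: card_image)
  then obtain x y where xy: "Arg2pi ` c = {x, y}" "x \<noteq> y" by (auto simp: card_2_iff)
  then show "Arg2pi ` c = {\<alpha>, \<beta>}" "\<alpha> \<noteq> \<beta>"
    unfolding \<alpha>_def \<beta>_def xy(1) by (auto simp: min_def max_def)
qed

lemma chord_at_angle:
  assumes D: "chord_set D" and c: "c \<in> D" "\<theta> \<in> Arg2pi ` c"
  shows "(THE d. d \<in> D \<and> cis \<theta> \<in> d) = c"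
proof (rule the_equality)
  have "c \<subseteq> sphere 0 1" using D c by (auto simp: chord_set_def)
  then have cis: "cis \<theta> \<in> c" using c(2) cis_Arg2pi by fastforce
  then show "c \<in> D \<and> cis \<theta> \<in> c" using c by simp
  show "d = c" if "d \<in> D \<and> cis \<theta> \<in> d" for d
    using D that c(1) cis unfolding chord_set_def disjoint_def by blast
qed

lemma weight_letter_at_chord:
  assumes "chord_set D" "c \<in> D" "\<theta> \<in> Arg2pi ` c"
  shows "weight_letter D \<iota> \<theta> =
    usl2_gen (sl2_basis (if \<theta> = Min (Arg2pi ` c) then fst (\<iota> c) else snd (\<iota> c)))"
  unfolding weight_letter_def chord_at_angle[OF assms] Let_def ..

lemma chord_angles_disjoint:
  assumes D: "chord_set D" and cd: "c \<in> D" "d \<in> D" "c \<noteq> d"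
  shows "Arg2pi ` c \<inter> Arg2pi ` d = {}"
  using chord_at_angle[OF D cd(1)] chord_at_angle[OF D cd(2)] cd(3) by blast

text \<open>
  By the Leibniz rule the commutator with \<open>X\<close> is a sum over the endpoints, which are grouped into
  the two ends of each chord. For a fixed chord and fixed labels of the other chords, the sum over the label of
  this chord is a contraction of \<open>t\<close> as in \<open>invariant_contraction\<close>, and vanishes.
\<close>

lemma weight_diagram_central:
  assumes t: "infinitesimal_R_matrix t" and D: "chord_set D"
  shows "weight_diagram t D * usl2_gen X = usl2_gen X * weight_diagram t D"
proof -
  define ts where "ts = rev (sorted_list_of_set (Arg2pi ` \<Union>D))"
  define coef where "coef \<iota> = (\<Prod>c\<in>D. t $ fst (\<iota> c) $ snd (\<iota> c))" for \<iota> :: "complex set \<Rightarrow> 3 \<times> 3"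
  define letter where "letter = weight_letter D"
  let ?x = "usl2_gen X" and ?I = "\<Pi>\<^sub>E c\<in>D. (UNIV :: (3 \<times> 3) set)"
  define P where "P \<iota> \<theta> = prod_list (map ((letter \<iota>)(\<theta> := ?x * letter \<iota> \<theta> - letter \<iota> \<theta> * ?x)) ts)" for \<iota> \<theta>
  have fin: "finite c" if "c \<in> D" for c
    using D that by (auto simp: chord_set_def card_2_iff)
  have finD: "finite D" using D by (simp add: chord_set_def)
  have ts: "distinct ts" "set ts = (\<Union>c\<in>D. Arg2pi ` c)"
    using finD fin by (auto simp: ts_def)
  have wd: "weight_diagram t D = (\<Sum>\<iota>\<in>?I. usl2_scale (coef \<iota>) (prod_list (map (letter \<iota>) ts)))"
    by (simp add: weight_diagram_def coef_def letter_def ts_def rev_map)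
  have "?x * weight_diagram t D - weight_diagram t D * ?x =
      (\<Sum>\<iota>\<in>?I. usl2_scale (coef \<iota>) (?x * prod_list (map (letter \<iota>) ts) - prod_list (map (letter \<iota>) ts) * ?x))"
    by (simp add: wd sum_distrib_left sum_distrib_right usl2_scale_mult_left usl2_scale_mult_right
        usl2_scale_diff_right sum_subtractf)
  also have "\<dots> = (\<Sum>\<iota>\<in>?I. usl2_scale (coef \<iota>) (\<Sum>c\<in>D. \<Sum>\<theta>\<in>Arg2pi ` c. P \<iota> \<theta>))"
  proof (rule sum.cong[OF refl])
    fix \<iota>
    have "?x * prod_list (map (letter \<iota>) ts) - prod_list (map (letter \<iota>) ts) * ?x = (\<Sum>\<theta>\<in>set ts. P \<iota> \<theta>)"
      unfolding P_def by (rule commutator_prod_list[OF ts(1)])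
    also have "\<dots> = (\<Sum>c\<in>D. \<Sum>\<theta>\<in>Arg2pi ` c. P \<iota> \<theta>)"
      unfolding ts(2) using finD fin chord_angles_disjoint[OF D]
      by (intro sum.UNION_disjoint) auto
    finally show "usl2_scale (coef \<iota>) (?x * prod_list (map (letter \<iota>) ts) - prod_list (map (letter \<iota>) ts) * ?x) =
        usl2_scale (coef \<iota>) (\<Sum>c\<in>D. \<Sum>\<theta>\<in>Arg2pi ` c. P \<iota> \<theta>)" by simp
  qed
  also have "\<dots> = (\<Sum>c\<in>D. \<Sum>\<iota>\<in>?I. usl2_scale (coef \<iota>) (\<Sum>\<theta>\<in>Arg2pi ` c. P \<iota> \<theta>))"
    by (simp only: usl2_scale_sum) (rule sum.swap)
  also have "\<dots> = (\<Sum>c\<in>D. 0)"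
  proof (rule sum.cong[OF refl])
    fix c assume c: "c \<in> D"
    define \<alpha> where "\<alpha> = Min (Arg2pi ` c)"
    define \<beta> where "\<beta> = Max (Arg2pi ` c)"
    have ends: "Arg2pi ` c = {\<alpha>, \<beta>}" "\<alpha> \<noteq> \<beta>"
      using chord_angles[OF D c] by (simp_all add: \<alpha>_def \<beta>_def)
    have in_ts: "\<alpha> \<in> set ts" "\<beta> \<in> set ts" unfolding ts(2) using ends(1) c by blast+
    \<comment> \<open>the labels \<open>\<kappa>\<close> of the other chords are fixed and the label \<open>p\<close> of \<open>c\<close> varies\<close>
    have "(\<Sum>p\<in>UNIV. usl2_scale (coef (\<kappa>(c := p))) (\<Sum>\<theta>\<in>Arg2pi ` c. P (\<kappa>(c := p)) \<theta>)) = 0" for \<kappa>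
    proof -
      \<comment> \<open>the product of letters with the two letters of the chord \<open>c\<close> left free\<close>
      define f where "f A B = prod_list (map ((letter \<kappa>)(\<alpha> := usl2_gen A, \<beta> := usl2_gen B)) ts)" for A B
      have letters: "letter (\<kappa>(c := p)) \<theta> =
          ((letter \<kappa>)(\<alpha> := usl2_gen (sl2_basis (fst p)), \<beta> := usl2_gen (sl2_basis (snd p)))) \<theta>"
        if "\<theta> \<in> set ts" for p \<theta>
      proof -
        obtain d where d: "d \<in> D" "\<theta> \<in> Arg2pi ` d" using \<open>\<theta> \<in> set ts\<close> unfolding ts(2) by blast
        show ?thesis
        proof (cases "d = c")
          case True
          have "letter (\<kappa>(c := p)) \<theta> = usl2_gen (sl2_basis (if \<theta> = \<alpha> then fst p else snd p))"
            unfolding letter_def \<alpha>_def using weight_letter_at_chord[OF D d, of "\<kappa>(c := p)"] True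
            by simp
          moreover have "\<theta> = \<alpha> \<or> \<theta> = \<beta>" using d(2) True ends(1) by simp
          ultimately show ?thesis using ends(2) by auto
        next
          case False
          then have "\<theta> \<noteq> \<alpha>" "\<theta> \<noteq> \<beta>"
            using chord_angles_disjoint[OF D d(1) c] d(2) unfolding ends(1) by blast+
          then show ?thesis
            using False by (simp add: letter_def weight_letter_at_chord[OF D d])
        qed
      qed
      have P1: "P (\<kappa>(c := p)) \<alpha> = f (bracket X (sl2_basis (fst p))) (sl2_basis (snd p))"
        and P2: "P (\<kappa>(c := p)) \<beta> = f (sl2_basis (fst p)) (bracket X (sl2_basis (snd p)))" for p
        unfolding P_def f_def using ends(2) in_ts
        by (intro arg_cong[where f = prod_list] map_cong refl; simp add: letters usl2_gen_bracket)+
      have "coef (\<kappa>(c := p)) = (\<Prod>d\<in>D - {c}. t $ fst (\<kappa> d) $ snd (\<kappa> d)) * t $ fst p $ snd p" for p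
        unfolding coef_def by (subst prod.remove[OF finD c]) (simp add: mult.commute)
      then have "(\<Sum>p\<in>UNIV. usl2_scale (coef (\<kappa>(c := p))) (\<Sum>\<theta>\<in>Arg2pi ` c. P (\<kappa>(c := p)) \<theta>)) =
          usl2_scale (\<Prod>d\<in>D - {c}. t $ fst (\<kappa> d) $ snd (\<kappa> d)) (\<Sum>p\<in>UNIV. usl2_scale (t $ fst p $ snd p)
            (f (bracket X (sl2_basis (fst p))) (sl2_basis (snd p)) + f (sl2_basis (fst p)) (bracket X (sl2_basis (snd p)))))"
        using ends by (simp add: P1 P2 usl2_scale_sum usl2_scale_scale)
      also have "\<dots> = 0"
      proof (subst invariant_contraction[OF t])
        show "f A B = (\<Sum>k\<in>UNIV. usl2_scale (sl2_coord A $ k) (f (sl2_basis k) B))" for A B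
          unfolding f_def fun_upd_twist[OF ends(2)] by (rule prod_list_linear_factor[OF ts(1) in_ts(1)])
        show "f A B = (\<Sum>k\<in>UNIV. usl2_scale (sl2_coord B $ k) (f A (sl2_basis k)))" for A B
          unfolding f_def by (rule prod_list_linear_factor[OF ts(1) in_ts(2)])
      qed simp
      finally show ?thesis .
    qed
    then show "(\<Sum>\<iota>\<in>?I. usl2_scale (coef \<iota>) (\<Sum>\<theta>\<in>Arg2pi ` c. P \<iota> \<theta>)) = 0"
      by (simp only: sum_PiE_split[OF c] sum.neutral_const)
  qed
  finally show ?thesis by simp
qed

section \<open>Infinitesimal R-matrices\<close>

lemma infinitesimal_R_matrix_killing_tensor: "infinitesimal_R_matrix killing_tensor"
proof -
  have "killing_tensor $ i $ j = killing_tensor $ j $ i" for i j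
    by (simp add: killing_tensor_def tensor_scale_def tensor_def)
  then have "transpose killing_tensor = killing_tensor"
    by (simp add: vec_eq_iff transpose_def)
  moreover have "tensor_ad X killing_tensor $ k $ l = 0" for X k l
    using exhaust_3[of k] exhaust_3[of l]
    by (auto simp: tensor_ad_def tensor_scale_def tensor_def sum_3 killing_tensor_def sl2_basis_def
      sl2_coord_bracket sl2_coord_basis)
  ultimately show ?thesis
    by (simp add: infinitesimal_R_matrix_def vec_eq_iff)
qed

text \<open>
  Invariance under \<open>H\<close> leaves the entries of weight zero, namely \<open>E \<otimes> F\<close>, \<open>F \<otimes> E\<close> and
  \<open>H \<otimes> H\<close>; invariance under \<open>E\<close> then fixes their ratio.
\<close>

lemma infinitesimal_R_matrix_multiple:
  assumes "infinitesimal_R_matrix t"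
  shows "t = tensor_scale (- 4 * t $ 1 $ 2) killing_tensor"
proof -
  have sym: "t $ i $ j = t $ j $ i" for i j
    using assms by (simp add: infinitesimal_R_matrix_def transpose_def vec_eq_iff)
  have ad: "tensor_ad X t $ k $ l = 0" for X k l
    using assms by (simp add: infinitesimal_R_matrix_def)
  note coords = tensor_ad_def tensor_scale_def tensor_def sum_3 sl2_basis_def sl2_coord_bracket sl2_coord_basis
  have "t $ 1 $ 1 = 0" "t $ 2 $ 2 = 0" "t $ 1 $ 3 = 0" "t $ 2 $ 3 = 0"
    using ad[of sl2_H 1 1] ad[of sl2_H 2 2] ad[of sl2_H 1 3] ad[of sl2_H 2 3] by (simp_all add: coords)
  moreover have "t $ 1 $ 2 = 2 * t $ 3 $ 3"
    using ad[of sl2_E 1 3] by (simp add: coords)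
  ultimately have "t $ k $ l = tensor_scale (- 4 * t $ 1 $ 2) killing_tensor $ k $ l" for k l
    using exhaust_3[of k] exhaust_3[of l] sym[of 2 1] sym[of 3 1] sym[of 3 2]
    by (auto simp: killing_tensor_def tensor_scale_def tensor_def sl2_coord_basis)
  then show ?thesis unfolding vec_eq_iff by blast
qed

section \<open>The weight system takes values in the centre\<close>

lemma usl2_centreI:
  assumes "\<And>X. u * usl2_gen X = usl2_gen X * u"
  shows "u \<in> usl2_centre"
proof -
  have gen: "u * (usl2_gen X * x) = usl2_gen X * x * u" if "u * x = x * u" for X x
    by (metis assms mult.assoc that)
  have "u * x = x * u" for x
    by (induction x rule: usl2_induct)
      (simp_all only: gen distrib_left distrib_right usl2_scale_mult_left usl2_scale_mult_right mult_1_left mult_1_right)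
  then show ?thesis by (simp add: usl2_centre_def)
qed

lemma usl2_centre_zero: "0 \<in> usl2_centre"
  by (simp add: usl2_centre_def)

lemma usl2_centre_sum: "(\<And>i. i \<in> S \<Longrightarrow> f i \<in> usl2_centre) \<Longrightarrow> sum f S \<in> usl2_centre"
  by (induction S rule: infinite_finite_induct) (simp_all add: usl2_centre_zero usl2_centre_add)

lemma chord_set_rep: "chord_set (rep_chord_diagram D)"
  using Quotient3_rep_reflp[OF Quotient3_chord_diagram, of D] by (simp add: chord_equiv_def)

lemma weight_diagram_in_centre:
  assumes "infinitesimal_R_matrix t"
  shows "weight_diagram t (rep_chord_diagram D) \<in> usl2_centre"
  by (rule usl2_centreI) (rule weight_diagram_central[OF assms chord_set_rep])

lemma weight_system_in_centre:
  assumes "infinitesimal_R_matrix t"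
  shows "weight_system t x \<in> usl2_centre"
  unfolding weight_system_def
  by (intro usl2_centre_sum usl2_centre_scale weight_diagram_in_centre assms)

text \<open>
  As central elements act by scalars on the highest weight module, the central character inherits additivity
  and multiplicativity from the action.
\<close>

lemma central_character_morphism: "algebra_morphism_on_centre (central_character z)"
  unfolding algebra_morphism_on_centre_def
  by (intro conjI ballI allI; rule central_character_eqI)
    (simp_all add: verma_act_one verma_act_add verma_act_mult verma_act_scale verma_act_centre smult_add_left)

lemma morphism_weight_system:
  assumes ch: "algebra_morphism_on_centre ch" and t: "infinitesimal_R_matrix t"
  shows "ch (weight_system t x) = (\<Sum>D\<in>Poly_Mapping.keys (rep_chord_space x).
    Poly_Mapping.lookup (rep_chord_space x) D * ch (weight_diagram t (rep_chord_diagram D)))"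
proof -
  have "ch (sum f S) = (\<Sum>i\<in>S. ch (f i))" if "\<And>i. f i \<in> usl2_centre" for f and S :: "chord_diagram set"
  proof (induction S rule: infinite_finite_induct)
    case empty
    show ?case using morphism_scale[OF ch usl2_centre_one, of 0] by simp
  next
    case (infinite S)
    then show ?case using morphism_scale[OF ch usl2_centre_one, of 0] by simp
  next
    case (insert i S)
    then show ?case by (simp add: morphism_add[OF ch] that usl2_centre_sum)
  qed
  then show ?thesis
    unfolding weight_system_def
    by (simp add: weight_diagram_in_centre[OF t] usl2_centre_scale morphism_scale[OF ch])
qed

section \<open>The trivial character and the zero tensor\<close>

lemma weight_diagram_zero:
  assumes "finite D"
  shows "weight_diagram 0 D = (if D = {} then 1 else 0)"
proof (cases "D = {}")
  case False
  then have "(0 :: complex) ^ card D = 0"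
    using assms by (simp add: card_gt_0_iff)
  then show ?thesis using False by (simp add: weight_diagram_def zero_power)
qed (simp add: weight_diagram_def)

lemma weight_diagram_empty: "weight_diagram t {} = 1"
  by (simp add: weight_diagram_def)

lemma verma_act_sum: "verma_act z (sum f S) p = (\<Sum>i\<in>S. verma_act z (f i) p)"
  by (induction S rule: infinite_finite_induct) (simp_all add: verma_act_add verma_act_zero)

text \<open>
  For \<open>z = 0\<close> the span of \<open>F\<^sup>k v\<^sub>0\<close> with \<open>k \<ge> 1\<close> is a submodule with trivial quotient: no generator
  produces a nonzero constant coefficient. So a product with at least one letter maps the highest weight
  vector into this submodule, while a central element multiplies it by its character.
\<close>

lemma trivial_character_weight_diagram:
  assumes t: "infinitesimal_R_matrix t" and D: "rep_chord_diagram D \<noteq> {}"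
  shows "central_character 0 (weight_diagram t (rep_chord_diagram D)) = 0"
proof -
  let ?D = "rep_chord_diagram D"
  define ts where "ts = rev (sorted_list_of_set (Arg2pi ` \<Union>?D))"
  have aug: "coeff (verma_act 0 (usl2_gen X * u) p) 0 = 0" for X u p
    by (simp add: verma_act_mult verma_act_gen verma_def verma_E_def verma_F_def verma_H_def)
  have D': "finite ?D" "\<And>c. c \<in> ?D \<Longrightarrow> finite c" "\<And>c. c \<in> ?D \<Longrightarrow> c \<noteq> {}"
    using chord_set_rep[of D] by (auto simp: chord_set_def card_2_iff)
  have "ts \<noteq> []" using D D' by (auto simp: ts_def)
  then obtain s ss where ts: "ts = s # ss" by (cases ts) auto
  have letter: "coeff (verma_act 0 (weight_letter ?D \<iota> s * u) 1) 0 = 0" for \<iota> u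
    unfolding weight_letter_def Let_def by (rule aug)
  have "weight_diagram t ?D = (\<Sum>\<iota>\<in>(\<Pi>\<^sub>E c\<in>?D. UNIV). usl2_scale (\<Prod>c\<in>?D. t $ fst (\<iota> c) $ snd (\<iota> c))
      (prod_list (map (weight_letter ?D \<iota>) ts)))"
    by (simp add: weight_diagram_def ts_def rev_map)
  then have "coeff (verma_act 0 (weight_diagram t ?D) 1) 0 = 0"
    by (simp add: verma_act_sum verma_act_scale coeff_sum ts letter)
  then show ?thesis
    by (simp add: verma_act_centre[OF weight_diagram_in_centre[OF t]])
qed

section \<open>Comparison with the coloured Jones polynomial\<close>

theorem theorem7:
  fixes G :: "(complex^2^2) set"
    and R :: "'v::complex_hilbert group_rep"
    and ch :: "usl2 \<Rightarrow> complex"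
    and t' :: "complex^3^3"
  assumes "real_form G"
    and "unitary_rep G R" and "irreducible_rep G R"
    and "infinitesimal_character G R ch"
    and "infinitesimal_R_matrix t'"
  shows "\<exists>c z. c \<noteq> 0 \<and>
    (\<forall>K. framed_knot K \<longrightarrow> rep_invariant ch (tensor_scale c t') K = coloured_jones z K)"
proof -
  have ch: "algebra_morphism_on_centre ch"
    using assms(4) by (simp add: infinitesimal_character_def)
  note kt = infinitesimal_R_matrix_killing_tensor
  \<comment> \<open>\<open>- 1 / 4\<close> is the coefficient of \<open>E \<otimes> F\<close> in the Killing tensor\<close>
  define b where "b = - 4 * t' $ 1 $ 2"
  have t': "t' = tensor_scale b killing_tensor"
    unfolding b_def by (rule infinitesimal_R_matrix_multiple[OF assms(5)])
  show ?thesis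
  proof (cases "b = 0")
    case True
    \<comment> \<open>the zero tensor cannot be rescaled to the Killing tensor; the trivial character takes its place\<close>
    then have zero: "tensor_scale 1 t' = 0" and R0: "infinitesimal_R_matrix 0"
      using assms(5) by (simp_all add: t' tensor_scale_def vec_eq_iff zero_vec_def[symmetric])
    have "ch (weight_diagram 0 (rep_chord_diagram D)) =
        central_character 0 (weight_diagram killing_tensor (rep_chord_diagram D))" for D
    proof (cases "rep_chord_diagram D = {}")
      case True
      then show ?thesis
        by (simp add: weight_diagram_empty morphism_one[OF ch] morphism_one[OF central_character_morphism])
    next
      case False
      have "finite (rep_chord_diagram D)" using chord_set_rep by (simp add: chord_set_def)
      moreover have "ch 0 = 0" using morphism_scale[OF ch usl2_centre_one, of 0] by simp
      ultimately show ?thesis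
        using False by (simp add: weight_diagram_zero trivial_character_weight_diagram[OF kt])
    qed
    then have "rep_invariant ch (tensor_scale 1 t') K = coloured_jones 0 K" for K
      unfolding rep_invariant_def coloured_jones_def zero
      by (simp add: morphism_weight_system[OF ch R0] morphism_weight_system[OF central_character_morphism kt])
    then show ?thesis by (intro exI[of _ 1] exI[of _ 0]) simp
  next
    case False
    then have killing: "tensor_scale (1 / b) t' = killing_tensor"
      by (simp add: t' tensor_scale_def vec_eq_iff)
    obtain z where z: "\<forall>u\<in>usl2_centre. ch u = central_character z u"
      using morphism_is_central_character[OF ch] by blast
    have "rep_invariant ch (tensor_scale (1 / b) t') K = coloured_jones z K" for K
      unfolding rep_invariant_def coloured_jones_def killing
      by (simp add: z weight_system_in_centre[OF kt])
    then show ?thesis using False by (intro exI[of _ "1 / b"] exI[of _ z]) simp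
  qed
qed

end
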